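(* Let $k\geq 2$, $a$ and $b$ be integers with $b\geq a$ and $k\leq a\leq 2k-2$. Then there exists a connected graph $G$ such that $cc_{k}(G)=a$ and $rc(G)=b$.
   Context: All graphs are finite, simple and undirected. An edge-coloring (not necessarily proper) of a graph is $k$-color connecting if between every pair of distinct vertices there is a path whose edges use at least $k$ different colors; $cc_{k}(G)$ is the minimum number of colors of such a coloring. A path is rainbow if its edges have pairwise distinct colors; $rc(G)$ is the minimum number of colors of an edge-coloring of $G$ in which every pair of distinct vertices is joined by a rainbow path. *)

theory Defs
  imports "Graph_Theory.Digraph_Component" "HOL-Library.Extended_Nat"
begin

text \<open>
  A finite simple undirected graph is a \<open>pair_graph\<close>, i.e. a finite loop-free symmetric digraph
  without parallel arcs: an undirected edge \<open>uv\<close> is the pair of arcs \<open>(u, v)\<close> and \<open>(v, u)\<close>.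
  An edge-coloring acts on the unordered edges \<open>{u, v}\<close>, so that the two arcs of an edge
  necessarily share one color; its values outside the edge set are irrelevant.
\<close>

definition uedges :: "'a pair_pre_digraph \<Rightarrow> 'a set set" where
  "uedges G = (\<lambda>(u, v). {u, v}) ` parcs G"

type_synonym 'a edge_coloring = "'a set \<Rightarrow> nat"

definition num_colors :: "'a pair_pre_digraph \<Rightarrow> 'a edge_coloring \<Rightarrow> nat" where
  "num_colors G c = card (c ` uedges G)"

definition path_colors :: "'a edge_coloring \<Rightarrow> ('a \<times> 'a) awalk \<Rightarrow> nat list" where
  "path_colors c p = map (\<lambda>(u, v). c {u, v}) p"

definition color_connecting :: "nat \<Rightarrow> 'a pair_pre_digraph \<Rightarrow> 'a edge_coloring \<Rightarrow> bool" where
  "color_connecting k G c \<longleftrightarrow>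
     (\<forall>u\<in>pverts G. \<forall>v\<in>pverts G. u \<noteq> v \<longrightarrow>
        (\<exists>p. pre_digraph.apath (with_proj G) u p v \<and> k \<le> card (set (path_colors c p))))"

definition rainbow_connecting :: "'a pair_pre_digraph \<Rightarrow> 'a edge_coloring \<Rightarrow> bool" where
  "rainbow_connecting G c \<longleftrightarrow>
     (\<forall>u\<in>pverts G. \<forall>v\<in>pverts G. u \<noteq> v \<longrightarrow>
        (\<exists>p. pre_digraph.apath (with_proj G) u p v \<and> distinct (path_colors c p)))"

text \<open>
  Both parameters live in \<^typ>\<open>enat\<close>: a graph may have no coloring of the required kind, in which
  case the infimum is \<open>\<infinity>\<close>; otherwise it is attained, i.e. it is a minimum.
\<close>

definition cc :: "nat \<Rightarrow> 'a pair_pre_digraph \<Rightarrow> enat" where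
  "cc k G = (INF c \<in> {c. color_connecting k G c}. enat (num_colors G c))"

definition rc :: "'a pair_pre_digraph \<Rightarrow> enat" where
  "rc G = (INF c \<in> {c. rainbow_connecting G c}. enat (num_colors G c))"

end

theory Submission
  imports Defs
begin

text \<open>
  Let \<open>k < a\<close> and put \<open>p = 2k - a\<close>, so that \<open>2 \<le> p < k\<close>. In a cycle of length \<open>2k - 1\<close> with a chord
  that cuts it into sides of lengths \<open>p\<close> and \<open>a - 1\<close>, a path with \<open>k\<close> colors between two vertices of
  the longer side whose arcs have lengths \<open>k\<close> and \<open>k - 1\<close> must be the arc of length \<open>k\<close>. Hence these
  arcs are rainbow, which makes all edges of the longer side differ in color and forces an additional
  color on the shorter side, so at least \<open>a\<close> colors are needed; \<open>a\<close> colors also suffice.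

  To adjust the rainbow connection number, a vertex \<open>w\<close> at distance \<open>k - 1\<close> from some other vertex is
  extended by a tail of \<open>b - (k - 1)\<close> large cliques, consecutive ones being completely joined. Now \<open>w\<close>
  is a cut vertex, so the tail does not help the cycle, and being dense it costs no new color in a
  \<open>k\<close>-color connecting coloring. It brings the diameter to \<open>b\<close>, and \<open>b\<close> colors suffice: the cycle is
  rainbow connected by \<open>k\<close> colors, only \<open>k - 1\<close> of which are needed on paths from \<open>w\<close>, while every
  layer of the tail gets its own color, the first one reusing the \<open>k\<close>-th color. For \<open>a = k\<close> the tail
  alone, attached to a single vertex, does.
\<close>

section \<open>Paths as vertex lists\<close>

text \<open>A path is handled as its list of vertices. The vertex set is not part of the predicate,
  so the same list can be read in a graph and in an extension of it.\<close>

definition joins :: "('a \<Rightarrow> 'a \<Rightarrow> bool) \<Rightarrow> 'a \<Rightarrow> 'a list \<Rightarrow> 'a \<Rightarrow> bool" where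
  "joins A u xs v \<longleftrightarrow> xs \<noteq> [] \<and> hd xs = u \<and> last xs = v \<and> distinct xs \<and> successively A xs"

fun path_edges :: "'a list \<Rightarrow> 'a set list" where
  "path_edges (x # y # zs) = {x, y} # path_edges (y # zs)"
| "path_edges _ = []"

definition graph_on :: "'a set \<Rightarrow> ('a \<Rightarrow> 'a \<Rightarrow> bool) \<Rightarrow> 'a pair_pre_digraph" where
  "graph_on V A = \<lparr>pverts = V, parcs = {(u, v). u \<in> V \<and> v \<in> V \<and> A u v}\<rparr>"

lemma length_path_edges [simp]: "length (path_edges xs) = length xs - 1"
  by (induction xs rule: path_edges.induct) auto

lemma path_edges_append:
  assumes "xs \<noteq> []" "ys \<noteq> []"
  shows "path_edges (xs @ ys) = path_edges xs @ {last xs, hd ys} # path_edges ys"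
  using assms
proof (induction xs rule: path_edges.induct)
  case ("2_2" x)
  then show ?case by (cases ys) auto
qed auto

lemma path_edges_Cons: "ys \<noteq> [] \<Longrightarrow> path_edges (x # ys) = {x, hd ys} # path_edges ys"
  by (cases ys) auto

lemma path_edges_rev: "path_edges (rev xs) = rev (path_edges xs)"
proof (induction xs rule: path_edges.induct)
  case (1 x y zs)
  then show ?case
    using path_edges_append[of "rev zs @ [y]" "[x]"] by (simp add: insert_commute)
qed auto

lemma path_edges_map:
  "path_edges (map f [i..<Suc j]) = map (\<lambda>q. {f q, f (Suc q)}) [i..<j]"
proof (induction j)
  case (Suc j)
  show ?case
  proof (cases "i \<le> j")
    case True
    then have "map f [i..<Suc (Suc j)] = map f [i..<Suc j] @ [f (Suc j)]" by simp
    also have "path_edges \<dots> = path_edges (map f [i..<Suc j]) @ [{f j, f (Suc j)}]"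
      using True by (subst path_edges_append) (auto simp: last_map)
    finally show ?thesis using True Suc by simp
  qed (auto simp: le_Suc_eq)
qed (cases i; simp)

lemma path_edges_conv_zip: "path_edges xs = map (\<lambda>(u, v). {u, v}) (zip xs (tl xs))"
  by (induction xs rule: path_edges.induct) auto

lemma set_path_edgesD:
  assumes "e \<in> set (path_edges xs)" "successively A xs"
  shows "\<exists>x\<in>set xs. \<exists>y\<in>set xs. e = {x, y} \<and> A x y"
  using assms
proof (induction xs rule: path_edges.induct)
  case (1 x y zs)
  show ?case
  proof (cases "e = {x, y}")
    case False
    with 1 have "\<exists>x\<in>set (y # zs). \<exists>z\<in>set (y # zs). e = {x, z} \<and> A x z" by simp
    then show ?thesis by (meson list.set_intros(2))
  qed (use 1 in force)
qed auto

lemma successively_upt: "(\<And>q. i \<le> q \<Longrightarrow> Suc q < j \<Longrightarrow> A q (Suc q)) \<Longrightarrow> successively A [i..<j]"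
proof (induction j)
  case (Suc j)
  then show ?case
    by (cases "i \<le> j"; cases j) (auto simp: successively_append_iff le_Suc_eq)
qed simp

lemma joins_Cons: "A x (hd ys) \<Longrightarrow> x \<notin> set ys \<Longrightarrow> joins A u ys v \<Longrightarrow> joins A x (x # ys) v"
  by (auto simp: joins_def successively_Cons)

lemma joins_rev:
  assumes "symp A" "joins A u xs v"
  shows "joins A v (rev xs) u"
proof -
  have "successively A xs" using assms by (simp add: joins_def)
  then have "successively (\<lambda>x y. A y x) xs"
    by (rule successively_mono) (use assms(1) in \<open>auto dest: sympD\<close>)
  with assms show ?thesis by (auto simp: joins_def hd_rev last_rev successively_rev)
qed

lemma joins_append:
  assumes "joins A u xs v" "joins A v' ys w" "A v v'" "set xs \<inter> set ys = {}"
  shows "joins A u (xs @ ys) w"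
  using assms by (auto simp: joins_def successively_append_iff)

lemma joins_mono:
  assumes "joins A u xs v" "\<And>x y. x \<in> set xs \<Longrightarrow> y \<in> set xs \<Longrightarrow> A x y \<Longrightarrow> B x y"
  shows "joins B u xs v"
proof -
  have "successively A xs" using assms(1) by (simp add: joins_def)
  then have "successively B xs" by (rule successively_mono) (rule assms(2))
  then show ?thesis using assms(1) by (simp add: joins_def)
qed

lemma joins_ends: "joins A u xs v \<Longrightarrow> u \<in> set xs \<and> v \<in> set xs"
  by (auto simp: joins_def)

section \<open>Arc walks versus vertex lists\<close>

lemma zip_pawalk_verts: "pcas u p v \<Longrightarrow> zip (pawalk_verts u p) (tl (pawalk_verts u p)) = p"
proof (induction p arbitrary: u)
  case (Cons e p)
  then show ?case by (cases p) auto
qed simp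

lemma pawalk_verts_zip:
  assumes "xs \<noteq> []"
  shows "pawalk_verts (hd xs) (zip xs (tl xs)) = xs" "pcas (hd xs) (zip xs (tl xs)) (last xs)"
  using assms by (induction xs rule: path_edges.induct) auto

lemma pawalk_verts_ends:
  "pcas u p v \<Longrightarrow> hd (pawalk_verts u p) = u \<and> last (pawalk_verts u p) = v \<and> pawalk_verts u p \<noteq> []"
proof (induction p arbitrary: u)
  case (Cons e p)
  then show ?case by (cases p) auto
qed simp

lemma successively_conv_zip: "successively A xs \<longleftrightarrow> (\<forall>(u, v)\<in>set (zip xs (tl xs)). A u v)"
  by (induction A xs rule: successively.induct) auto

lemma set_zip_tl_subset: "set (zip xs (tl xs)) \<subseteq> set xs \<times> set xs"
  by (induction xs rule: path_edges.induct) auto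

lemma path_colors_zip: "path_colors c (zip xs (tl xs)) = map c (path_edges xs)"
  by (simp add: path_colors_def path_edges_conv_zip case_prod_unfold)

text \<open>Taking \<open>pawalk_verts\<close> and zipping a list with its tail are inverse to each
  other and keep the sequence of colors. The parameter \<open>P\<close> lets one proof serve both
  notions of connecting.\<close>

lemma ex_apath_graph_on:
  "(\<exists>p. pre_digraph.apath (with_proj (graph_on V A)) u p v \<and> P (path_colors c p)) \<longleftrightarrow>
   (\<exists>xs. joins A u xs v \<and> set xs \<subseteq> V \<and> P (map c (path_edges xs)))"
proof
  assume "\<exists>p. pre_digraph.apath (with_proj (graph_on V A)) u p v \<and> P (path_colors c p)"
  then obtain p where p: "u \<in> V" "set p \<subseteq> parcs (graph_on V A)" "pcas u p v"
      "distinct (pawalk_verts u p)" "P (path_colors c p)"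
    by (auto simp: pre_digraph.apath_def pre_digraph.awalk_def cas_with_proj_eq
        awalk_verts_with_proj_eq graph_on_def)
  define xs where "xs = pawalk_verts u p"
  have z: "zip xs (tl xs) = p" and ends: "hd xs = u" "last xs = v" "xs \<noteq> []"
    using zip_pawalk_verts[OF p(3)] pawalk_verts_ends[OF p(3)] by (auto simp: xs_def)
  have "set xs \<subseteq> V"
    unfolding xs_def using p(1,2)
  proof (induction p arbitrary: u)
    case (Cons e p)
    then have "set (pawalk_verts (snd e) p) \<subseteq> V" by (intro Cons.IH) (auto simp: graph_on_def)
    with Cons.prems show ?case by (auto simp: graph_on_def)
  qed simp
  moreover have "joins A u xs v"
    using p ends z by (auto simp: joins_def successively_conv_zip graph_on_def xs_def)
  ultimately show "\<exists>xs. joins A u xs v \<and> set xs \<subseteq> V \<and> P (map c (path_edges xs))"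
    using p(5) path_colors_zip[of c xs] z by auto
next
  assume "\<exists>xs. joins A u xs v \<and> set xs \<subseteq> V \<and> P (map c (path_edges xs))"
  then obtain xs where xs: "joins A u xs v" "set xs \<subseteq> V" "P (map c (path_edges xs))" by blast
  have "set (zip xs (tl xs)) \<subseteq> parcs (graph_on V A)"
    using xs set_zip_tl_subset[of xs] by (fastforce simp: joins_def successively_conv_zip graph_on_def)
  moreover have "u \<in> V" using xs(1,2) joins_ends[OF xs(1)] by auto
  ultimately have "pre_digraph.apath (with_proj (graph_on V A)) u (zip xs (tl xs)) v"
    using xs pawalk_verts_zip[of xs]
    by (auto simp: pre_digraph.apath_def pre_digraph.awalk_def cas_with_proj_eq
        awalk_verts_with_proj_eq graph_on_def joins_def)
  then show "\<exists>p. pre_digraph.apath (with_proj (graph_on V A)) u p v \<and> P (path_colors c p)"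
    using xs(3) path_colors_zip[of c xs] by metis
qed

lemma pverts_graph_on [simp]: "pverts (graph_on V A) = V"
  by (simp add: graph_on_def)

lemma color_connecting_graph_on:
  "color_connecting k (graph_on V A) c \<longleftrightarrow>
    (\<forall>u\<in>V. \<forall>v\<in>V. u \<noteq> v \<longrightarrow>
      (\<exists>xs. joins A u xs v \<and> set xs \<subseteq> V \<and> k \<le> card (set (map c (path_edges xs)))))"
  unfolding color_connecting_def
  using ex_apath_graph_on[where P = "\<lambda>cs. k \<le> card (set cs)" and V = V and A = A and c = c]
  by simp

lemma rainbow_connecting_graph_on:
  "rainbow_connecting (graph_on V A) c \<longleftrightarrow>
    (\<forall>u\<in>V. \<forall>v\<in>V. u \<noteq> v \<longrightarrow>
      (\<exists>xs. joins A u xs v \<and> set xs \<subseteq> V \<and> distinct (map c (path_edges xs))))"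
  unfolding rainbow_connecting_def
  using ex_apath_graph_on[where P = distinct and V = V and A = A and c = c]
  by simp

lemma uedges_graph_on: "uedges (graph_on V A) = {{u, v} |u v. u \<in> V \<and> v \<in> V \<and> A u v}"
  by (auto simp: uedges_def graph_on_def)

lemma path_edges_subset_uedges:
  "joins A u xs v \<Longrightarrow> set xs \<subseteq> V \<Longrightarrow> set (path_edges xs) \<subseteq> uedges (graph_on V A)"
  unfolding uedges_graph_on joins_def using set_path_edgesD[of _ xs A] by blast

lemma finite_uedges_graph_on: "finite V \<Longrightarrow> finite (uedges (graph_on V A))"
  by (rule finite_subset[of _ "Pow V"]) (auto simp: uedges_graph_on)

lemma pair_graph_graph_on:
  assumes "finite V" "symp A" "\<And>x. \<not> A x x"
  shows "pair_graph (graph_on V A)"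
proof -
  have "finite {(u, v). u \<in> V \<and> v \<in> V \<and> A u v}"
    by (rule finite_subset[of _ "V \<times> V"]) (use assms in auto)
  then show ?thesis
    using assms by unfold_locales
      (auto simp: graph_on_def symmetric_def symp_def sym_def)
qed

lemma connected_if_rainbow_connecting:
  assumes "rainbow_connecting (graph_on V A) c" "V \<noteq> {}" "pair_graph (graph_on V A)"
  shows "Digraph_Component.connected (with_proj (graph_on V A))"
proof -
  interpret pair_graph "graph_on V A" by fact
  have "(u, v) \<in> rtrancl_on V ((parcs (graph_on V A))\<^sup>s)" if "u \<in> V" "v \<in> V" for u v
  proof (cases "u = v")
    case False
    with assms(1) that obtain p where "apath u p v"
      by (auto simp: rainbow_connecting_def)
    then have "(u, v) \<in> rtrancl_on V (parcs (graph_on V A))"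
      using reachable_apath by (auto simp: reachable_def)
    then show ?thesis
      by (rule rtrancl_on_mono[rotated 2]) (auto simp: symcl_def)
  qed (use that in simp)
  then show ?thesis using assms(2) by (simp add: connected_conv)
qed

lemma cc_eqI:
  assumes "color_connecting k G c" "num_colors G c \<le> a"
    and "\<And>c. color_connecting k G c \<Longrightarrow> a \<le> num_colors G c"
  shows "cc k G = enat a"
  unfolding cc_def using assms by (intro antisym INF_greatest INF_lower2[of c]) auto

lemma rc_eqI:
  assumes "rainbow_connecting G c" "num_colors G c \<le> b"
    and "\<And>c. rainbow_connecting G c \<Longrightarrow> b \<le> num_colors G c"
  shows "rc G = enat b"
  unfolding rc_def using assms by (intro antisym INF_greatest INF_lower2[of c]) auto

lemma successively_neq_if_distinct: "distinct xs \<Longrightarrow> successively (\<noteq>) xs"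
  by (induction xs rule: path_edges.induct) auto

lemma inj_on_mod: "inj_on (\<lambda>q. q mod k) {s..<s + k}" for k :: nat
proof (rule linorder_inj_onI)
  fix q r assume "q < r" "q \<in> {s..<s + k}" "r \<in> {s..<s + k}"
  then show "q mod k \<noteq> r mod k"
    using mod_eq_dvd_iff_nat[of q r k] by (auto dest!: dvd_imp_le)
qed auto

lemma path_edges_subset: "set xs \<subseteq> S \<Longrightarrow> e \<in> set (path_edges xs) \<Longrightarrow> e \<subseteq> S"
  by (induction xs rule: path_edges.induct) auto

text \<open>A potential that is 1-Lipschitz along edges bounds path lengths from below; this stands
  in for computing distances.\<close>

lemma abs_potential_le_length:
  fixes f :: "'a \<Rightarrow> int"
  assumes "successively A xs" "xs \<noteq> []"
    and "\<And>x y. x \<in> set xs \<Longrightarrow> y \<in> set xs \<Longrightarrow> A x y \<Longrightarrow> \<bar>f x - f y\<bar> \<le> 1"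
  shows "\<bar>f (hd xs) - f (last xs)\<bar> \<le> int (length xs) - 1"
  using assms
proof (induction xs rule: path_edges.induct)
  case (1 x y zs)
  then have "\<bar>f y - f (last (y # zs))\<bar> \<le> int (length (y # zs)) - 1" by simp
  moreover have "\<bar>f x - f y\<bar> \<le> 1" using 1 by simp
  ultimately show ?case by simp
qed auto

section \<open>Extending a graph by a tail of cliques\<close>

text \<open>The base has vertex set \<open>{..<n}\<close> and adjacency \<open>B\<close>; a tail of
  \<open>l\<close> levels hangs on its vertex \<open>w\<close>. The parameter \<open>k\<close>
  determines the size of the levels and the number of colors that recur in each of them.\<close>

locale tailed_graph =
  fixes n :: nat and B :: "nat \<Rightarrow> nat \<Rightarrow> bool" and w k l :: nat
  assumes B_sym: "symp B" and B_irrefl: "\<not> B x x" and w_less: "w < n" and l_pos: "0 < l"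
    and k_pos: "0 < k"
begin

abbreviation N :: nat where "N \<equiv> 3 * (k + 1)"

text \<open>Level \<open>i\<close> of the tail consists of the \<open>N\<close> vertices from \<open>n + N * i\<close> on; on the base, \<open>level\<close> is
  meaningless.\<close>

definition level :: "nat \<Rightarrow> nat" where "level v = (v - n) div N"

text \<open>As a relation the tail is infinite; \<open>V\<close> cuts it off after \<open>l\<close>
  levels.\<close>

definition A :: "nat \<Rightarrow> nat \<Rightarrow> bool" where
  "A u v \<longleftrightarrow> u < n \<and> v < n \<and> B u v
    \<or> n \<le> u \<and> n \<le> v \<and> u \<noteq> v \<and> level u \<le> Suc (level v) \<and> level v \<le> Suc (level u)
    \<or> u = w \<and> n \<le> v \<and> level v = 0 \<or> v = w \<and> n \<le> u \<and> level u = 0"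

abbreviation V :: "nat set" where "V \<equiv> {..<n + N * l}"

abbreviation G :: "nat pair_pre_digraph" where "G \<equiv> graph_on V A"

lemma level_block: "i < N \<Longrightarrow> level (n + N * m + i) = m"
  by (simp add: level_def add.assoc)

lemma level_less_iff: "n \<le> v \<Longrightarrow> level v < l \<longleftrightarrow> v \<in> V"
  unfolding level_def by (subst div_less_iff_less_mult) (auto simp: less_diff_conv2 mult.commute)

lemma less_if_level_less: "level x < level u \<Longrightarrow> x < u"
  using div_le_mono[of "u - n" "x - n" N] unfolding level_def by linarith

lemma A_sym: "symp A"
  using B_sym by (auto simp: symp_def A_def)

lemma pair_graph_G: "pair_graph G"
  using A_sym B_irrefl w_less by (intro pair_graph_graph_on) (auto simp: A_def)

lemma exits_through_w:
  "successively A (t # bs) \<Longrightarrow> n \<le> t \<Longrightarrow> last (t # bs) < n \<Longrightarrow> w \<in> set bs"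
proof (induction bs arbitrary: t)
  case (Cons b bs)
  then show ?case by (cases "n \<le> b") (auto simp: A_def)
qed auto

text \<open>A path between base vertices that visits a tail vertex \<open>t\<close> would meet
  \<open>w\<close> both before and after \<open>t\<close>, because \<open>w\<close> is the only base
  vertex with neighbours in the tail.\<close>

lemma stays_in_base:
  assumes "joins A u xs v" "u < n" "v < n"
  shows "joins B u xs v" "set xs \<subseteq> {..<n}"
proof -
  show base: "set xs \<subseteq> {..<n}"
  proof (rule ccontr)
    assume "\<not> set xs \<subseteq> {..<n}"
    then obtain t where t: "t \<in> set xs" "n \<le> t" by force
    then obtain as bs where xs: "xs = as @ t # bs" by (meson split_list)
    have "w \<in> set bs"
      using exits_through_w[of t bs] assms t xs by (auto simp: joins_def successively_append_iff)
    moreover have "joins A v (rev xs) u" using joins_rev[OF A_sym assms(1)] .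
    then have "w \<in> set (rev as)"
      using exits_through_w[of t "rev as"] assms t xs
      by (auto simp: joins_def successively_append_iff last_append)
    ultimately show False using assms(1) xs by (auto simp: joins_def)
  qed
  show "joins B u xs v"
    by (rule joins_mono[OF assms(1)]) (use base in \<open>auto simp: A_def\<close>)
qed

lemma joins_base: "joins B u xs v \<Longrightarrow> set xs \<subseteq> {..<n} \<Longrightarrow> joins A u xs v"
  by (erule joins_mono) (auto simp: A_def)

text \<open>Vertices are numbered by increasing level, so \<open>Max e\<close> is an end of
  \<open>e\<close> of highest level. All edges inside a level or from it downwards share one color,
  and a path down the tail changes color at every step.\<close>

definition rainbow_tail :: "nat \<Rightarrow> nat edge_coloring \<Rightarrow> nat edge_coloring" where
  "rainbow_tail h d e = (if e \<subseteq> {..<n} then d e else h + level (Max e))"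

text \<open>What matters are the edges between consecutively numbered vertices of a level: there the
  colors run cyclically through \<open>0..<k\<close>.\<close>

definition cyclic_tail :: "nat edge_coloring \<Rightarrow> nat edge_coloring" where
  "cyclic_tail c e = (if e \<subseteq> {..<n} then c e else Min e mod k)"

lemma map_rainbow_tail:
  "set xs \<subseteq> {..<n} \<Longrightarrow> map (rainbow_tail h d) (path_edges xs) = map d (path_edges xs)"
  using path_edges_subset[of xs "{..<n}"] by (simp add: rainbow_tail_def)

lemma map_cyclic_tail:
  "set xs \<subseteq> {..<n} \<Longrightarrow> map (cyclic_tail c) (path_edges xs) = map c (path_edges xs)"
  using path_edges_subset[of xs "{..<n}"] by (simp add: cyclic_tail_def)

text \<open>Rainbow paths from \<open>w\<close> that avoid all colors from \<open>h\<close> on can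
  be continued into the tail, although its first level is colored \<open>h\<close>, a color that the
  base may use elsewhere.\<close>

definition escapes :: "nat \<Rightarrow> nat edge_coloring \<Rightarrow> bool" where
  "escapes h d \<longleftrightarrow> (\<forall>v<n. \<exists>xs. joins B w xs v \<and> set xs \<subseteq> {..<n} \<and>
     distinct (map d (path_edges xs)) \<and> (\<forall>e\<in>set (path_edges xs). d e < h))"

text \<open>Each step down the tail lowers the level, and with it the color, by one; the step into
  \<open>w\<close> has color \<open>h\<close>, and the rest of the path has smaller colors by
  \<open>escapes\<close>. The bounds on levels and colors in the conclusion ensure that the vertex
  and the edge put in front are new.\<close>

lemma descending_path:
  assumes "escapes h d" "n \<le> u" "v < n \<or> n \<le> v \<and> level v < level u"
  shows "\<exists>ys. joins A u (u # ys) v \<and> (\<forall>y\<in>set ys. y < n \<or> level y < level u) \<and>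
    distinct (map (rainbow_tail h d) (path_edges (u # ys))) \<and>
    (\<forall>e\<in>set (path_edges (u # ys)). rainbow_tail h d e \<le> h + level u)"
  using assms(2,3)
proof (induction "level u" arbitrary: u)
  case less: 0
  then have "v < n" by simp
  then obtain xs where xs: "joins B w xs v" "set xs \<subseteq> {..<n}" "distinct (map d (path_edges xs))"
      "\<forall>e\<in>set (path_edges xs). d e < h"
    using assms(1) by (auto simp: escapes_def)
  have ne: "xs \<noteq> []" "hd xs = w" using xs(1) by (auto simp: joins_def)
  have eq: "map (rainbow_tail h d) (path_edges xs) = map d (path_edges xs)"
    using map_rainbow_tail xs(2) by blast
  have e: "rainbow_tail h d {u, w} = h"
    using less w_less by (simp add: rainbow_tail_def max_def)
  have lt: "\<forall>e\<in>set (path_edges xs). rainbow_tail h d e < h"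
    using xs(2,4) path_edges_subset[of xs "{..<n}"] by (simp add: rainbow_tail_def)
  have "joins A u (u # xs) v"
    by (rule joins_Cons[OF _ _ joins_base[OF xs(1,2)]]) (use less xs(2) ne in \<open>auto simp: A_def\<close>)
  moreover have "distinct (map (rainbow_tail h d) (path_edges (u # xs)))"
    using xs(3,4) e ne by (auto simp: path_edges_Cons eq)
  moreover have "\<forall>e\<in>set (path_edges (u # xs)). rainbow_tail h d e \<le> h + level u"
    using lt e ne by (auto simp: path_edges_Cons)
  ultimately show ?case using xs(2) by (intro exI[of _ xs]) auto
next
  case (Suc m)
  \<comment> \<open>The next vertex is \<open>v\<close> itself if it lies on level \<open>m\<close>,
    and otherwise the first vertex of that level.\<close>
  have "\<exists>x ys. n \<le> x \<and> level x = m \<and> joins A x (x # ys) v \<and>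
    (\<forall>y\<in>set (x # ys). y < n \<or> level y < level u) \<and>
    distinct (map (rainbow_tail h d) (path_edges (x # ys))) \<and>
    (\<forall>e\<in>set (path_edges (x # ys)). rainbow_tail h d e \<le> h + m)"
  proof (cases "n \<le> v \<and> level v = m")
    case True
    then show ?thesis using Suc by (intro exI[of _ v] exI[of _ "[]"]) (auto simp: joins_def)
  next
    case False
    define x where "x = n + N * m"
    have x: "n \<le> x" "level x = m" using level_block[of 0 m] by (auto simp: x_def)
    have "v < n \<or> n \<le> v \<and> level v < level x" using False Suc.prems(2) Suc.hyps(2) x by auto
    then obtain ys where "joins A x (x # ys) v" "\<forall>y\<in>set ys. y < n \<or> level y < level x"
      "distinct (map (rainbow_tail h d) (path_edges (x # ys)))"
      "\<forall>e\<in>set (path_edges (x # ys)). rainbow_tail h d e \<le> h + level x"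
      using Suc.hyps(1)[of x] x by blast
    moreover from this(2) have "\<forall>y\<in>set (x # ys). y < n \<or> level y < level u"
      using Suc.hyps(2) x by auto
    ultimately show ?thesis using x by blast
  qed
  then obtain x ys where x: "n \<le> x" "level x = m" "joins A x (x # ys) v"
    and below: "\<forall>y\<in>set (x # ys). y < n \<or> level y < level u"
    and rainbow: "distinct (map (rainbow_tail h d) (path_edges (x # ys)))"
    and colors: "\<forall>e\<in>set (path_edges (x # ys)). rainbow_tail h d e \<le> h + m"
    by blast
  have "x < u" using less_if_level_less x Suc.hyps by simp
  then have e: "rainbow_tail h d {u, x} = h + level u"
    using Suc x by (simp add: rainbow_tail_def max_def)
  have "joins A u (u # x # ys) v"
    by (rule joins_Cons[OF _ _ x(3)]) (use Suc x below in \<open>auto simp: A_def\<close>)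
  moreover have "distinct (map (rainbow_tail h d) (path_edges (u # x # ys)))"
    using rainbow colors e Suc.hyps(2)[symmetric] by auto
  moreover have "\<forall>e\<in>set (path_edges (u # x # ys)). rainbow_tail h d e \<le> h + level u"
    using colors e Suc.hyps(2)[symmetric] by auto
  ultimately show ?case using below by (intro exI[of _ "x # ys"]) auto
qed

text \<open>Two vertices of one level are adjacent; if the levels differ or one vertex is in the
  base, the higher vertex descends to the other.\<close>

lemma rainbow_connecting_tail:
  assumes "escapes h d"
    and base: "\<And>u v. u < n \<Longrightarrow> v < n \<Longrightarrow> u \<noteq> v \<Longrightarrow>
      \<exists>xs. joins B u xs v \<and> set xs \<subseteq> {..<n} \<and> distinct (map d (path_edges xs))"
  shows "rainbow_connecting G (rainbow_tail h d)"
proof -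
  let ?conn = "\<lambda>u v. \<exists>xs. joins A u xs v \<and> set xs \<subseteq> V \<and>
    distinct (map (rainbow_tail h d) (path_edges xs))"
  have conn_sym: "?conn v u" if "?conn u v" for u v
  proof -
    from that obtain xs where "joins A u xs v" "set xs \<subseteq> V"
      "distinct (map (rainbow_tail h d) (path_edges xs))" by blast
    then show ?thesis
      using joins_rev[OF A_sym, of u xs v]
      by (intro exI[of _ "rev xs"]) (auto simp: path_edges_rev rev_map[symmetric])
  qed
  have down: "?conn u v" if uv: "u \<in> V" "n \<le> u" "v \<in> V" "u \<noteq> v" "v < n \<or> level v \<le> level u" for u v
  proof (cases "n \<le> v \<and> level v = level u")
    case True
    then have "joins A u [u, v] v" using uv by (auto simp: joins_def A_def)
    then show ?thesis using uv by (intro exI[of _ "[u, v]"]) auto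
  next
    case False
    then obtain ys where ys: "joins A u (u # ys) v" "\<forall>y\<in>set ys. y < n \<or> level y < level u"
      "distinct (map (rainbow_tail h d) (path_edges (u # ys)))"
      using descending_path[OF assms(1) uv(2), of v] uv(5) by fastforce
    have "set ys \<subseteq> V"
    proof
      fix y assume "y \<in> set ys"
      with ys(2) have "y < n \<or> n \<le> y \<and> level y < level u" by force
      then show "y \<in> V" using level_less_iff[of u] level_less_iff[of y] uv by auto
    qed
    with ys uv show ?thesis by (intro exI[of _ "u # ys"]) auto
  qed
  have "?conn u v" if uv: "u \<in> V" "v \<in> V" "u \<noteq> v" for u v
  proof -
    consider "u < n" "v < n" | "n \<le> u" "v < n \<or> level v \<le> level u"
      | "n \<le> v" "u < n \<or> level u \<le> level v" by linarith
    then show ?thesis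
    proof cases
      case 1
      then obtain xs where xs: "joins B u xs v" "set xs \<subseteq> {..<n}"
        "distinct (map d (path_edges xs))" using base uv by blast
      then show ?thesis
        using joins_base[OF xs(1,2)] by (intro exI[of _ xs]) (auto simp only: map_rainbow_tail)
    next
      case 2
      then show ?thesis using down uv by blast
    next
      case 3
      then show ?thesis using down[of v u] conn_sym uv by blast
    qed
  qed
  then show ?thesis by (simp add: rainbow_connecting_graph_on)
qed

lemma uedges_G_cases:
  assumes "e \<in> uedges G"
  obtains u v where "u < n" "v < n" "B u v" "e = {u, v}"
  | u v where "e = {u, v}" "u < v" "n \<le> v" "v \<in> V" "u \<in> V"
proof -
  obtain u v where uv: "e = {u, v}" "u \<in> V" "v \<in> V" "A u v"
    using assms by (auto simp: uedges_graph_on)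
  consider "u < n" "v < n" | "u < v" "n \<le> v" | "v < u" "n \<le> u"
    using uv(4) w_less by (cases "u < v"; cases "v < u") (auto simp: A_def B_irrefl)
  then show thesis
    using uv that by cases (auto simp: A_def insert_commute)
qed

text \<open>\<open>rainbow_tail\<close> uses only colors below \<open>h + l\<close>. Conversely,
  \<open>f\<close> witnesses that \<open>t\<close> has distance at least \<open>h\<close> from
  \<open>w\<close>, so every path from \<open>t\<close> to the last level has at least
  \<open>h + l\<close> edges, which need as many colors if the path is rainbow.\<close>

lemma rc_tail:
  fixes f :: "nat \<Rightarrow> int"
  assumes escapes: "escapes h d"
    and base: "\<And>u v. u < n \<Longrightarrow> v < n \<Longrightarrow> u \<noteq> v \<Longrightarrow>
      \<exists>xs. joins B u xs v \<and> set xs \<subseteq> {..<n} \<and> distinct (map d (path_edges xs))"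
    and colors: "\<And>u v. B u v \<Longrightarrow> d {u, v} \<le> h"
    and f: "\<And>u v. u < n \<Longrightarrow> v < n \<Longrightarrow> B u v \<Longrightarrow> \<bar>f u - f v\<bar> \<le> 1" "f w = 0"
      "t < n" "f t = int h"
  shows "rc G = enat (h + l)" and "Digraph_Component.connected (with_proj G)"
proof -
  have con: "rainbow_connecting G (rainbow_tail h d)"
    using rainbow_connecting_tail[OF escapes base] .
  then show "Digraph_Component.connected (with_proj G)"
    using pair_graph_G w_less by (intro connected_if_rainbow_connecting) (auto simp: lessThan_empty_iff)
  show "rc G = enat (h + l)"
  proof (rule rc_eqI[OF con])
    have "rainbow_tail h d e < h + l" if "e \<in> uedges G" for e
      using that
    proof (cases rule: uedges_G_cases)
      case (1 u v)
      then show ?thesis using colors[of u v] l_pos by (simp add: rainbow_tail_def)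
    next
      case (2 u v)
      then show ?thesis using level_less_iff[of v] by (simp add: rainbow_tail_def max_def)
    qed
    then have "rainbow_tail h d ` uedges G \<subseteq> {..<h + l}" by auto
    then show "num_colors G (rainbow_tail h d) \<le> h + l"
      unfolding num_colors_def using card_mono[of "{..<h + l}"] by simp
  next
    fix c assume "rainbow_connecting G c"
    \<comment> \<open>This continues the potential into the tail: it is 0 at \<open>w\<close>, -1 on
      the first level, and drops by one per level.\<close>
    define g where "g v = (if v < n then f v else - int (level v) - 1)" for v
    define z where "z = n + N * (l - 1)"
    have z: "n \<le> z" "level z = l - 1" using level_block[of 0 "l - 1"] by (auto simp: z_def)
    then have "level z < l" using l_pos by simp
    then have zV: "z \<in> V" using level_less_iff[OF z(1)] by blast
    have "t \<noteq> z" "t \<in> V" using f(3) z by auto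
    with \<open>rainbow_connecting G c\<close> zV obtain xs where
      xs: "joins A t xs z" "set xs \<subseteq> V" "distinct (map c (path_edges xs))"
      unfolding rainbow_connecting_graph_on by blast
    have "\<bar>g x - g y\<bar> \<le> 1" if "A x y" for x y
      using that f(1)[of x y] f(2) w_less by (auto simp: A_def g_def)
    then have "\<bar>g (hd xs) - g (last xs)\<bar> \<le> int (length xs) - 1"
      using xs by (intro abs_potential_le_length[of A]) (auto simp: joins_def)
    then have "int h + int l \<le> int (length xs) - 1"
      using xs(1) f z l_pos by (simp add: joins_def g_def)
    then have "h + l \<le> length (map c (path_edges xs))" by simp
    also have "\<dots> = card (c ` set (path_edges xs))"
      using distinct_card[OF xs(3)] by simp
    also have "\<dots> \<le> num_colors G c"
      unfolding num_colors_def using path_edges_subset_uedges[OF xs(1,2)]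
      by (intro card_mono image_mono finite_imageI finite_uedges_graph_on) auto
    finally show "h + l \<le> num_colors G c" .
  qed
qed

text \<open>Any \<open>k + 1\<close> consecutive vertices of a level see all \<open>k\<close> colors of \<open>cyclic_tail\<close>. A level is the
  union of three such blocks, so some block avoids two given vertices.\<close>

lemma level_path:
  assumes "n \<le> u" "n \<le> v" "u \<noteq> v" "level u = level v"
  shows "\<exists>xs. joins A u xs v \<and> (\<forall>x\<in>set xs. n \<le> x \<and> level x = level u) \<and>
    k \<le> card (set (map (cyclic_tail c) (path_edges xs)))"
proof -
  define m where "m = level u"
  define b where "b x = (x - (n + N * m)) div (k + 1)" for x
  obtain i where i: "i < 3" "i \<noteq> b u" "i \<noteq> b v"
  proof -
    have "\<exists>i<3. i \<noteq> x \<and> i \<noteq> y" for x y :: nat by presburger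
    then show ?thesis using that by blast
  qed
  define s where "s = n + N * m + i * (k + 1)"
  have in_block: "n \<le> q \<and> level q = m \<and> b q = i" if "q \<in> {s..<Suc (s + k)}" for q
  proof -
    define j where "j = q - s"
    have q: "q = n + N * m + (i * (k + 1) + j)" "j < k + 1" using that by (auto simp: s_def j_def)
    have "i * (k + 1) \<le> 2 * (k + 1)" using i(1) by (intro mult_right_mono) auto
    then have "i * (k + 1) + j < N" using q(2) by simp
    then have "level q = m" unfolding q(1) by (rule level_block)
    moreover have "b q = i"
      using q(2) unfolding b_def q(1) diff_add_inverse by (subst div_mult_self3) auto
    ultimately show ?thesis using q(1) by simp
  qed
  define ps where "ps = [s..<Suc (s + k)]"
  have ps: "ps \<noteq> []" "set ps = {s..<Suc (s + k)}" "distinct ps" by (auto simp: ps_def simp del: upt_Suc)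
  have lev: "\<forall>x\<in>set (u # ps @ [v]). n \<le> x \<and> level x = m"
    using in_block assms m_def ps(2) by auto
  have "u \<notin> set ps" "v \<notin> set ps" using in_block i(2,3) ps(2) by blast+
  then have dist: "distinct (u # ps @ [v])" using ps(3) assms(3) by simp
  \<comment> \<open>A level is a clique, so any list of distinct vertices in it is a path.\<close>
  have "successively (\<noteq>) (u # ps @ [v])"
    using dist by (rule successively_neq_if_distinct)
  then have "successively A (u # ps @ [v])"
    by (rule successively_mono) (use lev in \<open>auto simp: A_def\<close>)
  with dist have "joins A u (u # ps @ [v]) v" by (simp add: joins_def)
  moreover have "k \<le> card (set (map (cyclic_tail c) (path_edges (u # ps @ [v]))))"
  proof -
    have "path_edges ps = map (\<lambda>q. {q, Suc q}) [s..<s + k]"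
      using path_edges_map[of "\<lambda>x. x" s "s + k"] by (simp add: ps_def del: upt_Suc)
    moreover have "cyclic_tail c {q, Suc q} = q mod k" if "q \<in> {s..<s + k}" for q
      using in_block[of q] that by (simp add: cyclic_tail_def)
    ultimately have "map (cyclic_tail c) (path_edges ps) = map (\<lambda>q. q mod k) [s..<s + k]" by simp
    then have "card (set (map (cyclic_tail c) (path_edges ps))) = k"
      using card_image[OF inj_on_mod[of k s]] by simp
    moreover have "set (path_edges ps) \<subseteq> set (path_edges (u # ps @ [v]))"
      using ps(1) by (auto simp: path_edges_Cons path_edges_append)
    then have "card (set (map (cyclic_tail c) (path_edges ps)))
        \<le> card (set (map (cyclic_tail c) (path_edges (u # ps @ [v]))))"
      by (intro card_mono) auto
    ultimately show ?thesis by simp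
  qed
  ultimately show ?thesis using lev unfolding m_def by blast
qed

text \<open>The \<open>k\<close> colors are collected on a detour inside the level of the higher
  vertex \<open>u\<close>, from \<open>u\<close> to another vertex \<open>x\<close>. From
  \<open>x\<close> the path descends to \<open>v\<close>; everything after \<open>x\<close> lies
  below that level and therefore misses the detour.\<close>

lemma color_connecting_tail:
  assumes "escapes h d"
    and base: "\<And>u v. u < n \<Longrightarrow> v < n \<Longrightarrow> u \<noteq> v \<Longrightarrow>
      \<exists>xs. joins B u xs v \<and> set xs \<subseteq> {..<n} \<and> k \<le> card (set (map c (path_edges xs)))"
  shows "color_connecting k G (cyclic_tail c)"
proof -
  let ?conn = "\<lambda>u v. \<exists>xs. joins A u xs v \<and> set xs \<subseteq> V \<and>
    k \<le> card (set (map (cyclic_tail c) (path_edges xs)))"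
  have conn_sym: "?conn v u" if "?conn u v" for u v
  proof -
    from that obtain xs where "joins A u xs v" "set xs \<subseteq> V"
      "k \<le> card (set (map (cyclic_tail c) (path_edges xs)))" by blast
    then show ?thesis
      using joins_rev[OF A_sym, of u xs v]
      by (intro exI[of _ "rev xs"]) (auto simp: path_edges_rev)
  qed
  have in_V: "x \<in> V" if "u \<in> V" "n \<le> u" "x < n \<or> level x \<le> level u" for x u
    using that level_less_iff[of u] level_less_iff[of x] by (cases "x < n") auto
  have down: "?conn u v" if uv: "u \<in> V" "n \<le> u" "v \<in> V" "u \<noteq> v" "v < n \<or> level v \<le> level u" for u v
  proof (cases "n \<le> v \<and> level v = level u")
    case True
    then obtain xs where "joins A u xs v" "\<forall>x\<in>set xs. n \<le> x \<and> level x = level u"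
      "k \<le> card (set (map (cyclic_tail c) (path_edges xs)))"
      using level_path[of u v c] uv by auto
    then show ?thesis using in_V[OF uv(1,2)] by (intro exI[of _ xs]) auto
  next
    case False
    obtain x where x: "x \<noteq> u" "n \<le> x" "level x = level u"
    proof -
      have "level (n + N * level u + i) = level u" if "i < 2" for i
        using level_block[of i "level u"] that by simp
      from this[of 0] this[of 1] show ?thesis
        using that[of "n + N * level u"] that[of "n + N * level u + 1"]
        by (cases "u = n + N * level u") auto
    qed
    then obtain xs where xs: "joins A u xs x" "\<forall>x\<in>set xs. n \<le> x \<and> level x = level u"
      "k \<le> card (set (map (cyclic_tail c) (path_edges xs)))"
      using level_path[of u x c] uv by auto
    obtain ys where ys: "joins A x (x # ys) v" "\<forall>y\<in>set ys. y < n \<or> level y < level x"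
      using descending_path[OF assms(1) x(2), of v] uv(5) x(3) False by fastforce
    have "ys \<noteq> []" using ys(1) uv x False by (auto simp: joins_def)
    then have "joins A (hd ys) ys v" "A x (hd ys)"
      using ys(1) by (auto simp: joins_def successively_Cons)
    moreover have "y \<notin> set ys" if "y \<in> set xs" for y
      using bspec[OF xs(2) that] bspec[OF ys(2), of y] x(3) by auto
    then have "set xs \<inter> set ys = {}" by blast
    ultimately have "joins A u (xs @ ys) v" using xs(1) by (intro joins_append) auto
    moreover have "set (xs @ ys) \<subseteq> V"
    proof
      fix y assume "y \<in> set (xs @ ys)"
      then have "y < n \<or> level y \<le> level u" using xs(2) ys(2) x(3) by fastforce
      then show "y \<in> V" by (rule in_V[OF uv(1,2)])
    qed
    moreover have "set (path_edges xs) \<subseteq> set (path_edges (xs @ ys))"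
      using xs(1) \<open>ys \<noteq> []\<close> by (auto simp: path_edges_append joins_def)
    then have "card (set (map (cyclic_tail c) (path_edges xs)))
        \<le> card (set (map (cyclic_tail c) (path_edges (xs @ ys))))"
      by (intro card_mono) auto
    ultimately show ?thesis using xs(3) by (meson le_trans)
  qed
  have "?conn u v" if uv: "u \<in> V" "v \<in> V" "u \<noteq> v" for u v
  proof -
    consider "u < n" "v < n" | "n \<le> u" "v < n \<or> level v \<le> level u"
      | "n \<le> v" "u < n \<or> level u \<le> level v" by linarith
    then show ?thesis
    proof cases
      case 1
      then obtain xs where xs: "joins B u xs v" "set xs \<subseteq> {..<n}"
        "k \<le> card (set (map c (path_edges xs)))" using base uv by blast
      then show ?thesis
        using joins_base map_cyclic_tail[of xs c] by (intro exI[of _ xs]) auto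
    next
      case 2
      then show ?thesis using down uv by blast
    next
      case 3
      then show ?thesis using down[of v u] conn_sym uv by blast
    qed
  qed
  then show ?thesis by (simp add: color_connecting_graph_on)
qed

text \<open>The tail only needs colors below \<open>k\<close>, so it adds none to the
  \<open>a\<close> colors of the base. The lower bound is inherited because, by
  \<open>stays_in_base\<close>, a coloring of the whole graph restricts to the base. The alternative
  \<open>a = k\<close> serves a one-vertex base: there a single path with \<open>k\<close> colors
  gives the bound.\<close>

lemma cc_tail:
  assumes escapes: "escapes h d"
    and base: "\<And>u v. u < n \<Longrightarrow> v < n \<Longrightarrow> u \<noteq> v \<Longrightarrow>
      \<exists>xs. joins B u xs v \<and> set xs \<subseteq> {..<n} \<and> k \<le> card (set (map c (path_edges xs)))"
    and colors: "\<And>u v. B u v \<Longrightarrow> c {u, v} < a" "k \<le> a"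
    and lower: "a = k \<or> (\<forall>c. color_connecting k (graph_on {..<n} B) c \<longrightarrow>
      a \<le> num_colors (graph_on {..<n} B) c)"
  shows "cc k G = enat a"
proof (rule cc_eqI)
  show "color_connecting k G (cyclic_tail c)" using color_connecting_tail[OF escapes base] .
  have "cyclic_tail c e < a" if "e \<in> uedges G" for e
    using that
  proof (cases rule: uedges_G_cases)
    case (1 u v)
    then show ?thesis using colors(1)[of u v] by (simp add: cyclic_tail_def)
  next
    case (2 u v)
    have "Min e mod k < k" using k_pos by simp
    with 2 show ?thesis using colors(2) by (auto simp: cyclic_tail_def)
  qed
  then have "cyclic_tail c ` uedges G \<subseteq> {..<a}" by auto
  then show "num_colors G (cyclic_tail c) \<le> a"
    unfolding num_colors_def using card_mono[of "{..<a}"] by simp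
next
  fix c assume con: "color_connecting k G c"
  from lower show "a \<le> num_colors G c"
  proof
    assume "a = k"
    have "n \<in> V" "w \<in> V" "n \<noteq> w" using w_less l_pos by auto
    with con obtain xs where "joins A n xs w" "set xs \<subseteq> V"
      "k \<le> card (set (map c (path_edges xs)))"
      unfolding color_connecting_graph_on by blast
    moreover from this have "card (c ` set (path_edges xs)) \<le> num_colors G c"
      unfolding num_colors_def using path_edges_subset_uedges[of A n xs w V]
      by (intro card_mono image_mono finite_imageI finite_uedges_graph_on) auto
    ultimately show ?thesis using \<open>a = k\<close> by simp
  next
    assume *: "\<forall>c. color_connecting k (graph_on {..<n} B) c \<longrightarrow>
      a \<le> num_colors (graph_on {..<n} B) c"
    have "color_connecting k (graph_on {..<n} B) c"
      unfolding color_connecting_graph_on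
    proof (intro ballI impI)
      fix u v assume "u \<in> {..<n}" "v \<in> {..<n}" "u \<noteq> v"
      moreover from this obtain xs where "joins A u xs v" "k \<le> card (set (map c (path_edges xs)))"
        using con unfolding color_connecting_graph_on by force
      ultimately show "\<exists>xs. joins B u xs v \<and> set xs \<subseteq> {..<n} \<and>
          k \<le> card (set (map c (path_edges xs)))"
        using stays_in_base[of u xs v] by auto
    qed
    with * have "a \<le> num_colors (graph_on {..<n} B) c" by blast
    also have "uedges (graph_on {..<n} B) \<subseteq> uedges G"
      unfolding uedges_graph_on A_def by fastforce
    then have "num_colors (graph_on {..<n} B) c \<le> num_colors G c"
      unfolding num_colors_def
      by (intro card_mono image_mono finite_imageI finite_uedges_graph_on) auto
    finally show ?thesis .
  qed
qed

end

section \<open>Residues, and edges forced on a path\<close>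

lemma image_mod_interval: "0 < n \<Longrightarrow> (\<lambda>q. q mod n) ` {s..<s + n} = {..<n}" for n :: nat
  by (rule card_subset_eq) (auto simp: card_image inj_on_mod)

lemma eq_if_mod_eq:
  "q mod n = r mod n \<Longrightarrow> s \<le> q \<Longrightarrow> q < s + n \<Longrightarrow> s \<le> r \<Longrightarrow> r < s + n \<Longrightarrow> q = r" for n :: nat
  using inj_onD[OF inj_on_mod[of n s], of q r] by simp

lemma successively_one_side:
  assumes "successively A ys" "set ys \<subseteq> X \<union> Y"
    and "\<And>x y. x \<in> X \<Longrightarrow> y \<in> Y \<Longrightarrow> \<not> A x y \<and> \<not> A y x"
  shows "set ys \<subseteq> X \<or> set ys \<subseteq> Y"
  using assms(1,2)
proof (induction ys rule: path_edges.induct)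
  case (1 x y zs)
  then have "set (y # zs) \<subseteq> X \<or> set (y # zs) \<subseteq> Y" by simp
  moreover have "x \<in> X \<or> x \<in> Y" "A x y" using 1 by auto
  ultimately show ?case using assms(3) by auto
qed auto

text \<open>An interior vertex of a path has two different neighbours on it; if \<open>a\<close> and
  \<open>b\<close> are the only candidates, both edges are used.\<close>

lemma interior_edges:
  assumes "joins A u xs v" "z \<in> set xs" "z \<noteq> u" "z \<noteq> v"
    and "\<And>y. y \<in> set xs \<Longrightarrow> A z y \<or> A y z \<Longrightarrow> y = a \<or> y = b"
  shows "{a, z} \<in> set (path_edges xs)" "{z, b} \<in> set (path_edges xs)"
proof -
  obtain as bs where xs: "xs = as @ z # bs" using assms(2) by (meson split_list)
  have ne: "as \<noteq> []" "bs \<noteq> []" using assms xs by (auto simp: joins_def)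
  have "A (last as) z" "A z (hd bs)"
    using assms(1) ne by (auto simp: joins_def xs successively_append_iff successively_Cons)
  moreover have "set as \<inter> set bs = {}" using assms(1) by (auto simp: joins_def xs)
  then have "last as \<noteq> hd bs" using hd_in_set[OF ne(2)] last_in_set[OF ne(1)] by auto
  ultimately have "{last as, hd bs} = {a, b}"
    using assms(5)[of "last as"] assms(5)[of "hd bs"] ne xs by fastforce
  moreover have "{last as, z} \<in> set (path_edges xs)" "{z, hd bs} \<in> set (path_edges xs)"
    using ne by (auto simp: xs path_edges_append path_edges_Cons)
  ultimately show "{a, z} \<in> set (path_edges xs)" "{z, b} \<in> set (path_edges xs)"
    by (auto simp: doubleton_eq_iff insert_commute)
qed

text \<open>Every vertex of a nontrivial path has some neighbour on it, and here \<open>a\<close> is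
  the only candidate.\<close>

lemma only_edge:
  assumes "joins A u xs v" "u \<noteq> v" "z \<in> set xs"
    and "\<And>y. y \<in> set xs \<Longrightarrow> A z y \<or> A y z \<Longrightarrow> y = a"
  shows "{a, z} \<in> set (path_edges xs)"
proof -
  obtain as bs where xs: "xs = as @ z # bs" using assms(3) by (meson split_list)
  consider "as \<noteq> []" | "bs \<noteq> []" using assms(1,2) xs by (cases "as = []"; cases "bs = []") (auto simp: joins_def)
  then show ?thesis
  proof cases
    case 1
    then have "A (last as) z" using assms(1) by (auto simp: joins_def xs successively_append_iff)
    then have "last as = a" using assms(4)[of "last as"] 1 xs by simp
    then show ?thesis using 1 by (auto simp: xs path_edges_append)
  next
    case 2
    then have "A z (hd bs)"
      using assms(1) by (auto simp: joins_def xs successively_append_iff successively_Cons)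
    then have "hd bs = a" using assms(4)[of "hd bs"] 2 xs by simp
    moreover have "{z, hd bs} \<in> set (path_edges xs)"
      using 2 by (cases "as = []") (simp_all add: xs path_edges_append path_edges_Cons)
    ultimately show ?thesis by (simp add: insert_commute)
  qed
qed

section \<open>A cycle with a chord\<close>

locale chorded_cycle =
  fixes k p :: nat
  assumes p_ge: "2 \<le> p" and p_less: "p < k"
begin

definition n :: nat where "n = 2 * k - 1"

definition B :: "nat \<Rightarrow> nat \<Rightarrow> bool" where
  "B u v \<longleftrightarrow> u < n \<and> v < n \<and> (v = Suc u mod n \<or> u = Suc v mod n \<or> {u, v} = {0, p})"

text \<open>Edges of the cycle are indexed by arbitrary naturals read modulo \<open>n\<close>, so
  that arcs running past \<open>0\<close> are still plain intervals. The shorter side consists of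
  the edges \<open>0..<p\<close>, the longer one of \<open>p..<n\<close>.\<close>

definition E :: "nat \<Rightarrow> nat set" where "E q = {q mod n, Suc q mod n}"

lemma n_simps: "n + 1 = 2 * k" "p + 1 < n" "0 < n" "2 < n" "k < n"
  using p_ge p_less by (auto simp: n_def)

lemma B_sym: "symp B"
  by (auto simp: symp_def B_def doubleton_eq_iff)

lemma B_irrefl: "\<not> B x x"
  using n_simps p_ge by (auto simp: B_def mod_Suc doubleton_eq_iff split: if_splits)

lemma E_add_n: "E (q + n) = E q"
  by (simp add: E_def flip: add_Suc)

lemma B_cases:
  assumes "B u v"
  obtains q where "q < n" "{u, v} = E q" | "{u, v} = {0, p}"
proof -
  have "{u, v} = E u" if "u < n" "v = Suc u mod n" using that by (simp add: E_def)
  moreover have "{u, v} = E v" if "v < n" "u = Suc v mod n" using that by (auto simp: E_def)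
  ultimately show thesis using assms that unfolding B_def by blast
qed

lemma E_in_uedges: "E q \<in> uedges (graph_on {..<n} B)"
proof -
  have "B (q mod n) (Suc q mod n)" using n_simps by (simp add: B_def mod_Suc_eq)
  moreover have "q mod n < n" "Suc q mod n < n" using n_simps by auto
  ultimately show ?thesis unfolding uedges_graph_on E_def by blast
qed

lemma E_eqD:
  assumes "E q = E r"
  shows "q mod n = r mod n"
proof -
  \<comment> \<open>A crossed match of the ends would make 2 a multiple of \<open>n\<close>.\<close>
  have "\<not> (a = (if Suc b = n then 0 else Suc b) \<and> (if Suc a = n then 0 else Suc a) = b)" for a b
    using n_simps(4) by auto
  then show ?thesis
    using assms unfolding E_def doubleton_eq_iff mod_Suc by blast
qed

definition arc :: "nat \<Rightarrow> nat \<Rightarrow> nat list" where "arc i j = map (\<lambda>q. q mod n) [i..<Suc j]"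

lemma arc:
  assumes "i \<le> j" "j < i + n"
  shows "joins B (i mod n) (arc i j) (j mod n)" "set (arc i j) \<subseteq> {..<n}"
    "path_edges (arc i j) = map E [i..<j]" "set (arc i j) = (\<lambda>q. q mod n) ` {i..j}"
proof -
  have "inj_on (\<lambda>q. q mod n) {i..<Suc j}"
    using inj_on_mod[of n i] by (rule inj_on_subset) (use assms in auto)
  then have "distinct (arc i j)" by (simp add: arc_def distinct_map del: upt_Suc)
  moreover have "successively B (arc i j)"
    unfolding arc_def successively_map
    by (rule successively_upt) (use n_simps in \<open>auto simp: B_def mod_Suc_eq\<close>)
  moreover have "arc i j \<noteq> []" "hd (arc i j) = i mod n" "last (arc i j) = j mod n"
    using assms by (auto simp: arc_def hd_map last_map simp del: upt_Suc)
  ultimately show "joins B (i mod n) (arc i j) (j mod n)" by (simp add: joins_def)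
  show "set (arc i j) \<subseteq> {..<n}" using n_simps by (auto simp: arc_def)
  show "path_edges (arc i j) = map E [i..<j]"
    unfolding arc_def path_edges_map E_def ..
  show "set (arc i j) = (\<lambda>q. q mod n) ` {i..j}"
    by (auto simp: arc_def simp del: upt_Suc)
qed

lemma arc_below: "j < n \<Longrightarrow> set (arc i j) = {i..j}"
  by (auto simp: arc_def simp del: upt_Suc)

text \<open>Vertices off the chord have only their cycle neighbours; \<open>0 < r\<close> keeps
  \<open>r - 1\<close> from being truncated.\<close>

lemma neighbours:
  assumes "B (r mod n) y \<or> B y (r mod n)" "r mod n \<noteq> 0" "r mod n \<noteq> p" "0 < r"
  shows "y = (r - 1) mod n \<or> y = Suc r mod n"
proof -
  obtain t where "r = Suc t" using assms(4) by (cases r) auto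
  with assms show ?thesis
    by (auto simp: B_def mod_Suc doubleton_eq_iff split: if_splits)
qed

text \<open>The windows are the arcs with \<open>k\<close> edges both of whose ends lie on the longer side of the
  chord. The complementary arc has only \<open>k - 1\<close> edges and the chord is no way out, so a path with
  \<open>k\<close> colors joining the two ends has to run along the window itself.\<close>

lemma window_inj_on:
  assumes con: "color_connecting k (graph_on {..<n} B) c"
    and s: "p \<le> s \<and> s + 1 \<le> k \<or> p + k \<le> s + 1 \<and> s \<le> n"
  shows "inj_on (\<lambda>q. c (E q)) {s..<s + k}"
proof -
  let ?f = "\<lambda>q. q mod n"
  define u v where "u = s mod n" and "v = (s + k) mod n"
  define X where "X = ?f ` {s<..<s + k}"
  define Y where "Y = ?f ` {s + k<..<s + n}"
  have cover: "{..<n} \<subseteq> X \<union> Y \<union> {u, v}"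
  proof
    fix y assume "y \<in> {..<n}"
    then obtain q where q: "q \<in> {s..<s + n}" "y = q mod n"
      using image_mod_interval[of n s] n_simps by blast
    consider "q = s" | "q = s + k" | "q \<in> {s<..<s + k}" | "q \<in> {s + k<..<s + n}"
      using q(1) by force
    then show "y \<in> X \<union> Y \<union> {u, v}"
      using q(2) by cases (auto simp: X_def Y_def u_def v_def)
  qed
  have s_pos: "0 < s" using s p_ge p_less by auto
  have uv: "u \<noteq> v" "u < n" "v < n"
    using eq_if_mod_eq[of s n "s + k" s] n_simps p_less by (auto simp: u_def v_def)
  have no_edge: "\<not> B x y" if xy: "x \<in> X" "y \<in> Y" for x y
  proof
    assume "B x y"
    obtain q where q: "x = q mod n" "s < q" "q < s + k" using xy(1) unfolding X_def by force
    obtain r where r: "y = r mod n" "s + k < r" "r < s + n" using xy(2) unfolding Y_def by force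
    have 1: "y \<noteq> Suc x mod n"
      using eq_if_mod_eq[of r n "Suc q" s] q r by (auto simp: mod_Suc_eq)
    have 2: "x \<noteq> Suc y mod n"
    proof (cases "Suc r = s + n")
      case True
      then have "Suc y mod n = s mod n" using r(1) by (simp add: mod_Suc_eq)
      then show ?thesis using eq_if_mod_eq[of q n s s] q n_simps by auto
    next
      case False
      then show ?thesis using eq_if_mod_eq[of q n "Suc r" s] q r by (auto simp: mod_Suc_eq)
    qed
    \<comment> \<open>Either the window lies in the longer side and its interior misses both ends of
      the chord, or it contains the whole shorter side and the interior of the complementary arc
      misses them.\<close>
    have "x \<notin> {0, p} \<or> y \<notin> {0, p}"
      using s
    proof
      assume "p \<le> s \<and> s + 1 \<le> k"
      then have "q < n" "p < q" using q n_simps by auto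
      then show ?thesis using q(1) by auto
    next
      assume "p + k \<le> s + 1 \<and> s \<le> n"
      then have "n + p < r" "r < 2 * n" using r n_simps by auto
      then have "y = r - n" using r(1) by (simp add: mod_if)
      with \<open>n + p < r\<close> show ?thesis by auto
    qed
    with 1 2 \<open>B x y\<close> show False unfolding B_def doubleton_eq_iff by auto
  qed
  obtain xs where xs: "joins B u xs v" "set xs \<subseteq> {..<n}"
    and card_xs: "k \<le> card (set (map c (path_edges xs)))"
    using con uv unfolding color_connecting_graph_on by blast
  obtain ys where ys: "xs = u # ys @ [v]"
  proof -
    have "xs = u # tl xs" "tl xs \<noteq> []" "last (tl xs) = v"
      using xs(1) uv(1) by (cases xs; auto simp: joins_def split: if_splits)+
    then have "xs = u # butlast (tl xs) @ [v]" using append_butlast_last_id[of "tl xs"] by simp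
    then show ?thesis by (rule that)
  qed
  have ys_props: "distinct ys" "successively B ys" "set ys \<subseteq> X \<union> Y"
    using xs cover by (auto simp: ys joins_def successively_Cons successively_append_iff)
  \<comment> \<open>There are at least \<open>k\<close> edges, hence at least \<open>k - 1\<close>
    interior vertices. This is the size of \<open>X\<close>, while \<open>Y\<close> has only
    \<open>k - 2\<close> elements.\<close>
  have len: "k \<le> length ys + 1"
    using le_trans[OF card_xs card_length] by (simp add: ys)
  have "set ys \<subseteq> X \<or> set ys \<subseteq> Y"
    using ys_props no_edge B_sym by (intro successively_one_side[of B]) (auto dest: sympD)
  moreover have "\<not> set ys \<subseteq> Y"
  proof
    assume "set ys \<subseteq> Y"
    then have "length ys \<le> card Y"
      using ys_props(1) card_mono[of Y "set ys"] by (simp add: distinct_card Y_def)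
    also have "\<dots> \<le> n - k - 1"
      unfolding Y_def using card_image_le[of "{s + k<..<s + n}" ?f] n_simps by simp
    finally show False using len n_simps p_less by auto
  qed
  ultimately have "set ys \<subseteq> X" by blast
  moreover have "card X \<le> k - 1"
    unfolding X_def using card_image_le[of "{s<..<s + k}" ?f] by simp
  ultimately have len_eq: "length ys = k - 1" and "set ys = X"
    using ys_props(1) len card_mono[of X "set ys"] card_seteq[of X "set ys"]
    by (auto simp: distinct_card X_def)
  then have set_xs: "set xs = ?f ` {s..s + k}"
  proof -
    have "{s..s + k} = insert s (insert (s + k) {s<..<s + k})" by auto
    then show ?thesis using \<open>set ys = X\<close> by (auto simp: ys X_def u_def v_def)
  qed
  \<comment> \<open>Exactly \<open>k\<close> edges carry \<open>k\<close> colors, so the path is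
    rainbow.\<close>
  have "length (path_edges xs) = k" using len_eq p_less by (simp add: ys)
  then have "distinct (map c (path_edges xs))"
    using card_xs card_length[of "map c (path_edges xs)"] by (intro card_distinct) simp
  then have inj_c: "inj_on c (set (path_edges xs))" by (simp add: distinct_map)
  \<comment> \<open>The vertex set alone does not exclude that the path uses the chord. But
    \<open>0\<close> and \<open>p\<close> are not consecutive, so every edge of the window has an
    end \<open>r\<close> off the chord. If \<open>r\<close> is interior to the path, both its cycle
    edges are used; if it is an end, its one neighbour inside the window decides.\<close>
  have "E q \<in> set (path_edges xs)" if q: "q \<in> {s..<s + k}" for q
  proof -
    obtain r where r: "r = q \<or> r = Suc q" "r mod n \<noteq> 0" "r mod n \<noteq> p"
    proof -
      have "\<not> (q mod n \<in> {0, p} \<and> Suc q mod n \<in> {0, p})"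
        using n_simps p_ge by (auto simp: mod_Suc split: if_splits)
      then show ?thesis using that by blast
    qed
    have range: "s \<le> r" "r \<le> s + k" using r(1) q by auto
    then have r_in: "r mod n \<in> set xs" unfolding set_xs by auto
    have nb: "y = (r - 1) mod n \<or> y = Suc r mod n" if "B (r mod n) y \<or> B y (r mod n)" for y
      using neighbours[OF that r(2,3)] range s_pos by simp
    consider "s < r" "r < s + k" | "r = s" | "r = s + k" using range by linarith
    then show ?thesis
    proof cases
      case 1
      then have "r mod n \<noteq> u" "r mod n \<noteq> v"
        using eq_if_mod_eq[of r n s s] eq_if_mod_eq[of r n "s + k" s] n_simps
        by (auto simp: u_def v_def)
      then have "{(r - 1) mod n, r mod n} \<in> set (path_edges xs)"
        "{r mod n, Suc r mod n} \<in> set (path_edges xs)"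
        using interior_edges[OF xs(1) r_in] nb by blast+
      then show ?thesis using r(1) by (auto simp: E_def)
    next
      case 2
      have "(s - 1) mod n \<notin> set xs"
      proof
        assume "(s - 1) mod n \<in> set xs"
        then obtain t where t: "(s - 1 + n) mod n = t mod n" "s \<le> t" "t \<le> s + k"
          unfolding set_xs by auto
        then have "s - 1 + n = t" using s_pos n_simps by (intro eq_if_mod_eq[OF t(1), of s]) auto
        then show False using t n_simps p_less p_ge by auto
      qed
      then have "{Suc r mod n, r mod n} \<in> set (path_edges xs)"
        using nb 2 by (intro only_edge[OF xs(1) uv(1) r_in]) auto
      moreover have "q = r" using 2 r(1) q by auto
      ultimately show ?thesis by (simp add: E_def insert_commute)
    next
      case 3
      have "Suc r mod n \<notin> set xs"
      proof
        assume "Suc r mod n \<in> set xs"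
        then obtain t where t: "Suc r mod n = t mod n" "s \<le> t" "t \<le> s + k"
          unfolding set_xs by auto
        then have "Suc r = t" using 3 n_simps p_less p_ge
          by (intro eq_if_mod_eq[OF t(1), of s]) auto
        then show False using t 3 by auto
      qed
      then have "{(r - 1) mod n, r mod n} \<in> set (path_edges xs)"
        using nb 3 by (intro only_edge[OF xs(1) uv(1) r_in]) auto
      moreover have "r = Suc q" using 3 r(1) q by auto
      ultimately show ?thesis by (simp add: E_def)
    qed
  qed
  then have "E ` {s..<s + k} \<subseteq> set (path_edges xs)" by blast
  moreover have "inj_on E {s..<s + k}"
  proof (rule inj_onI)
    fix q r assume "q \<in> {s..<s + k}" "r \<in> {s..<s + k}" "E q = E r"
    then show "q = r" using eq_if_mod_eq[OF E_eqD, of q r s] n_simps by simp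
  qed
  ultimately show ?thesis
    using comp_inj_on[of E "{s..<s + k}" c] inj_on_subset[OF inj_c] by (simp add: comp_def)
qed

text \<open>Any two edges of the longer side lie in a common window, so its \<open>n - p\<close>
  edges differ in color, and so do the \<open>p\<close> edges of the shorter side. An edge of the
  shorter side can share its color only with the \<open>p - 1\<close> edges
  \<open>k..<p + k - 1\<close> of the longer side, so some edge of the shorter side has a further
  color.\<close>

lemma num_colors_ge:
  assumes con: "color_connecting k (graph_on {..<n} B) c"
  shows "n - p + 1 \<le> num_colors (graph_on {..<n} B) c"
proof -
  define g where "g q = c (E q)" for q
  have window: "g q \<noteq> g r" if "p \<le> s \<and> s + 1 \<le> k \<or> p + k \<le> s + 1 \<and> s \<le> n"
    "q \<in> {s..<s + k}" "r \<in> {s..<s + k}" "q \<noteq> r" for q r s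
    using window_inj_on[OF con that(1)] that(2-) unfolding g_def inj_on_def by blast
  have g_add: "g (q + n) = g q" for q by (simp add: g_def E_add_n)
  have inj_R: "inj_on g {p..<n}"
  proof (rule linorder_inj_onI)
    fix q r assume qr: "q < r" "q \<in> {p..<n}" "r \<in> {p..<n}"
    show "g q \<noteq> g r"
    proof (cases "r - q < k")
      case True
      \<comment> \<open>The window ends with the edge \<open>r\<close>, unless it would then begin
        before \<open>p\<close>.\<close>
      then show ?thesis using qr n_simps p_less by (intro window[of "max p (r + 1 - k)"]) auto
    next
      case False
      \<comment> \<open>Edges this far apart on one side are at most \<open>k - 1\<close> apart the
        other way around, so the window beginning with \<open>r\<close> reaches
        \<open>q + n\<close>.\<close>
      then have "g (q + n) \<noteq> g r" using qr n_simps by (intro window[of r]) auto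
      then show ?thesis by (simp add: g_add)
    qed
  qed auto
  \<comment> \<open>The extreme windows are used: the one from \<open>n\<close> on covers the edges
    \<open>0..<k\<close>, the one from \<open>p + k - 1\<close> on the end of the longer side and
    all of the shorter side.\<close>
  have P: "g q \<noteq> g r" if "q < p" "r < n" "q \<noteq> r" "r < k \<or> p + k \<le> r + 1" for q r
    using that(4)
  proof
    assume "r < k"
    then have "g (q + n) \<noteq> g (r + n)"
      using that n_simps p_less by (intro window[of n]) auto
    then show ?thesis by (simp add: g_add)
  next
    assume "p + k \<le> r + 1"
    then have "g (q + n) \<noteq> g r"
      using that n_simps p_less by (intro window[of "p + k - 1"]) auto
    then show ?thesis by (simp add: g_add)
  qed
  have "\<not> g ` {..<p} \<subseteq> g ` {p..<n}"
  proof
    assume sub: "g ` {..<p} \<subseteq> g ` {p..<n}"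
    have "g ` {..<p} \<subseteq> g ` {k..<p + k - 1}"
    proof
      fix x assume "x \<in> g ` {..<p}"
      then obtain q r where qr: "q < p" "x = g q" "r \<in> {p..<n}" "x = g r" using sub by blast
      then have "\<not> (r < k \<or> p + k \<le> r + 1)" using P[of q r] by auto
      with qr(4) show "x \<in> g ` {k..<p + k - 1}" by auto
    qed
    then have "card (g ` {..<p}) \<le> card {k..<p + k - 1}"
      by (meson card_image_le card_mono finite_atLeastLessThan finite_imageI le_trans)
    moreover have "inj_on g {..<p}"
      using P p_less n_simps by (intro linorder_inj_onI) auto
    ultimately show False using p_ge by (simp add: card_image)
  qed
  then obtain q where q: "g q \<notin> g ` {p..<n}" by blast
  have "n - p + 1 = card (insert (g q) (g ` {p..<n}))"
    using q card_image[OF inj_R] by simp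
  also have "\<dots> \<le> num_colors (graph_on {..<n} B) c"
    unfolding num_colors_def g_def using E_in_uedges
    by (intro card_mono finite_imageI finite_uedges_graph_on) auto
  finally show ?thesis .
qed

section \<open>A coloring of the chorded cycle with \<open>n - p + 1\<close> colors\<close>

definition edge_color :: "(nat \<Rightarrow> nat) \<Rightarrow> nat \<Rightarrow> nat edge_coloring" where
  "edge_color g x e =
    (if Max e = Suc (Min e) then g (Min e) else if Min e = 0 \<and> Max e = n - 1 then g (n - 1) else x)"

text \<open>\<open>edge_color\<close> recovers the index of a cycle edge from its ends: they are
  consecutive numbers, except on the closing edge between \<open>n - 1\<close> and \<open>0\<close>.
  The remaining value \<open>x\<close> is for the chord.\<close>

lemma edge_color_E: "edge_color g x (E q) = g (q mod n)"
proof (cases "Suc (q mod n) = n")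
  case True
  then have "E q = {n - 1, 0}" by (auto simp: E_def mod_Suc)
  moreover have "q mod n = n - 1" using True by simp
  moreover have "n - 1 \<noteq> Suc 0" using n_simps by linarith
  ultimately show ?thesis by (simp add: edge_color_def)
next
  case False
  then have "E q = {q mod n, Suc (q mod n)}" by (simp add: E_def mod_Suc)
  then show ?thesis by (simp add: edge_color_def)
qed

lemma edge_color_chord: "edge_color g x {0, p} = x"
proof -
  have "p \<noteq> n - 1" "p \<noteq> Suc 0" using n_simps p_ge by linarith+
  then show ?thesis by (simp add: edge_color_def)
qed

lemma edge_color_bound:
  assumes "\<And>q. q < n \<Longrightarrow> g q < m" "x < m" "B u v"
  shows "edge_color g x {u, v} < m"
  using assms(3) by (cases rule: B_cases) (use assms(1,2) in \<open>auto simp: edge_color_E edge_color_chord\<close>)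

lemma edge_color_arc:
  assumes "i \<le> j" "j < i + n"
  shows "map (edge_color g x) (path_edges (arc i j)) = map (\<lambda>q. g (q mod n)) [i..<j]"
  by (simp add: arc(3)[OF assms] edge_color_E)

text \<open>The chord and the last edge of the shorter side get the extra color; the other edges of the
  shorter side repeat, in the order in which they are met from the end \<open>0\<close> of the chord, the
  colors of the middle edges of the longer side.\<close>

definition side_color :: "nat \<Rightarrow> nat" where
  "side_color q = (if p \<le> q then q - p else if Suc q = p then n - p else k - 2 - q)"

abbreviation C :: "nat edge_coloring" where "C \<equiv> edge_color side_color (n - p)"

definition many_colors :: "nat \<Rightarrow> nat \<Rightarrow> bool" where
  "many_colors u v \<longleftrightarrow>
    (\<exists>xs. joins B u xs v \<and> set xs \<subseteq> {..<n} \<and> k \<le> card (set (map C (path_edges xs))))"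

lemma many_colors_sym: "many_colors u v \<Longrightarrow> many_colors v u"
proof -
  assume "many_colors u v"
  then obtain xs where "joins B u xs v" "set xs \<subseteq> {..<n}" "k \<le> card (set (map C (path_edges xs)))"
    unfolding many_colors_def by blast
  then show ?thesis
    unfolding many_colors_def using joins_rev[OF B_sym, of u xs v]
    by (intro exI[of _ "rev xs"]) (auto simp: path_edges_rev)
qed

lemma many_colorsI:
  assumes "joins B u xs v" "set xs \<subseteq> {..<n}" "T \<subseteq> set (map C (path_edges xs))" "k \<le> card T"
  shows "many_colors u v"
  unfolding many_colors_def using assms card_mono[OF _ assms(3)] by (intro exI[of _ xs]) auto

lemma many_colors_arc:
  assumes "i \<le> j" "j < i + n" "T \<subseteq> (\<lambda>q. side_color (q mod n)) ` {i..<j}" "k \<le> card T"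
  shows "many_colors (i mod n) (j mod n)"
  using arc(1,2)[OF assms(1,2)]
  by (rule many_colorsI[OF _ _ _ assms(4)]) (use assms(3) in \<open>simp add: edge_color_arc[OF assms(1,2)]\<close>)

lemma side_color_image:
  assumes "p \<le> i" "j \<le> n" shows "{i - p..<j - p} = side_color ` {i..<j}"
proof (intro equalityI subsetI)
  fix t assume "t \<in> {i - p..<j - p}"
  then have "t = side_color (t + p)" "t + p \<in> {i..<j}" by (auto simp: side_color_def)
  then show "t \<in> side_color ` {i..<j}" by blast
qed (use assms in \<open>auto simp: side_color_def\<close>)

text \<open>The colors \<open>k - p..k - 2\<close> belong to the edges \<open>k..k + p - 2\<close>
  of the longer side, precisely those whose colors the shorter side may repeat by the argument for
  the lower bound.\<close>

lemma side_color_short: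
  assumes "t \<in> {k - p..k - 2}" shows "t = side_color (k - 2 - t)" "k - 2 - t < p - 1"
  using assms p_ge p_less by (auto simp: side_color_def)

text \<open>The way around passes the entire longer side, whose \<open>n - p\<close> colors are at
  least \<open>k\<close> many.\<close>

lemma many_colors_within_shorter:
  assumes "u < v" "v \<le> p"
  shows "many_colors u v"
proof -
  have "{0..<n - p} \<subseteq> (\<lambda>q. side_color (q mod n)) ` {v..<u + n}"
  proof
    fix t assume "t \<in> {0..<n - p}"
    then have "t = side_color ((t + p) mod n)" "t + p \<in> {v..<u + n}"
      using assms by (auto simp: side_color_def)
    then show "t \<in> (\<lambda>q. side_color (q mod n)) ` {v..<u + n}" by blast
  qed
  then have "many_colors (v mod n) ((u + n) mod n)"
    by (rule many_colors_arc[rotated 2]) (use assms n_simps p_less in auto)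
  then show ?thesis using many_colors_sym assms n_simps by simp
qed

text \<open>If the arc from \<open>u\<close> to \<open>v\<close> has \<open>k\<close> edges, it
  suffices, since the longer side is rainbow. Otherwise the complementary arc loses few colors: the
  shorter side lies on it and supplies the middle colors and the extra one. The value
  \<open>v = n\<close> stands for the vertex \<open>0\<close> as an end of the longer side.\<close>

lemma many_colors_within_longer:
  assumes "p \<le> u" "u < v" "v \<le> n"
  shows "many_colors (u mod n) (v mod n)"
proof (cases "k \<le> v - u")
  case True
  have "(\<lambda>q. side_color (q mod n)) ` {u..<v} = side_color ` {u..<v}"
    using assms by (intro image_cong) auto
  then have "{u - p..<v - p} \<subseteq> (\<lambda>q. side_color (q mod n)) ` {u..<v}"
    using side_color_image assms by simp
  then show ?thesis
    by (rule many_colors_arc[rotated 2]) (use True assms p_ge in auto)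
next
  case False
  \<comment> \<open>The colors that may be lost lie outside the middle range
    \<open>k - p..k - 2\<close>; hence \<open>i\<close> and \<open>j\<close> are clipped
    there.\<close>
  define i j where "i = min (u - p) (k - p)" and "j = max (v - p) (k - 1)"
  define T where "T = {..n - p} - ({i..<k - p} \<union> {k - 1..<j})"
  let ?S = "(\<lambda>q. side_color (q mod n)) ` {v..<u + n}"
  have "T \<subseteq> ?S"
  proof
    fix t assume t: "t \<in> T"
    consider "t < u - p" | "k - p \<le> t" "t \<le> k - 2" | "v - p \<le> t" "t < n - p" | "t = n - p"
      using t unfolding T_def i_def j_def by force
    then show "t \<in> ?S"
    proof cases
      case 1
      then have "t = side_color ((t + p + n) mod n)" "t + p + n \<in> {v..<u + n}"
        using assms by (auto simp: side_color_def)
      then show ?thesis by blast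
    next
      case 2
      then obtain q where q: "t = side_color q" "q < p - 1" using side_color_short[of t] by auto
      then have "t = side_color ((q + n) mod n)" "q + n \<in> {v..<u + n}"
        using assms n_simps by auto
      then show ?thesis by blast
    next
      case 3
      then have "t = side_color ((t + p) mod n)" "t + p \<in> {v..<u + n}"
        using assms by (auto simp: side_color_def)
      then show ?thesis by blast
    next
      case 4
      obtain q where q: "p = Suc q" using p_ge by (cases p) auto
      then have "side_color q = t" "(q + n) mod n = q" "q + n \<in> {v..<u + n}"
        using 4 assms n_simps unfolding side_color_def by simp_all
      then have "t = side_color ((q + n) mod n)" "q + n \<in> {v..<u + n}" by simp_all
      then show ?thesis by blast
    qed
  qed
  moreover have "k \<le> card T"
  proof -
    define gap where "gap = (k - p - i) + (j - (k - 1))"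
    have "card ({i..<k - p} \<union> {k - 1..<j}) \<le> gap"
      unfolding gap_def using card_Un_le[of "{i..<k - p}" "{k - 1..<j}"] by simp
    moreover have "card {..n - p} - card ({i..<k - p} \<union> {k - 1..<j}) \<le> card T"
      unfolding T_def by (rule diff_card_le_card_Diff) simp
    \<comment> \<open>Of the \<open>n - p + 1 = 2 * k - p\<close> colors at most
      \<open>k - p\<close> are lost.\<close>
    moreover have "gap + k \<le> n - p + 1"
      using False assms n_simps p_ge p_less unfolding gap_def i_def j_def
      by (simp split: split_min split_max)
    moreover have "card {..n - p} = n - p + 1" by simp
    ultimately show ?thesis by linarith
  qed
  ultimately have "many_colors (v mod n) ((u + n) mod n)"
    by (rule many_colors_arc[rotated 2]) (use assms in auto)
  then show ?thesis using many_colors_sym by simp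
qed

text \<open>The path goes over the chord, in one of its two directions. Via \<open>0\<close> and
  then \<open>p\<close> it sees the colors \<open>0..k - 2\<close> and \<open>n - p\<close> if
  \<open>v\<close> is far enough from \<open>p\<close>; otherwise, via \<open>p\<close> and then
  \<open>0\<close>, it sees \<open>k - p..n - p\<close>. Both sets have \<open>k\<close> elements.
  That the shorter side repeats its colors in descending order is what makes them join up with those
  of the longer side.\<close>

lemma many_colors_across:
  assumes u: "0 < u" "u < p" and v: "p < v" "v < n"
  shows "many_colors u v"
proof (cases "k \<le> v - p + u + 1")
  case True
  let ?xs = "rev (arc 0 u) @ arc p v"
  have "joins B u (rev (arc 0 u)) 0" "joins B p (arc p v) v"
    using joins_rev[OF B_sym arc(1)[of 0 u]] arc(1)[of p v] u v by auto
  moreover have "set (rev (arc 0 u)) \<inter> set (arc p v) = {}" "B 0 p"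
    using arc_below u v by (auto simp: B_def)
  ultimately have joins: "joins B u ?xs v" by (intro joins_append)
  have ne: "rev (arc 0 u) \<noteq> []" "arc p v \<noteq> []" "last (rev (arc 0 u)) = 0" "hd (arc p v) = p"
    using \<open>joins B u (rev (arc 0 u)) 0\<close> \<open>joins B p (arc p v) v\<close> by (auto simp: joins_def)
  have colors: "set (map C (path_edges ?xs)) =
      side_color ` {0..<u} \<union> {n - p} \<union> side_color ` {p..<v}"
  proof -
    have "set (map C (path_edges (arc 0 u))) = side_color ` {0..<u}"
      using u v by (subst edge_color_arc) auto
    moreover have "set (map C (path_edges (arc p v))) = side_color ` {p..<v}"
      using u v by (subst edge_color_arc) auto
    ultimately show ?thesis
      using ne by (simp add: path_edges_append path_edges_rev edge_color_chord image_Un)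
  qed
  have "insert (n - p) {..k - 2} \<subseteq> set (map C (path_edges ?xs))"
  proof -
    have "t \<in> side_color ` {0..<u} \<union> side_color ` {p..<v}" if "t \<le> k - 2" for t
    proof (cases "t < v - p")
      case True
      then show ?thesis using side_color_image[of p v] v by auto
    next
      case False
      then have "k - 2 - t < u" "k - p \<le> t" using \<open>k \<le> v - p + u + 1\<close> u that by auto
      then show ?thesis using side_color_short[of t] that by auto
    qed
    then show ?thesis unfolding colors by auto
  qed
  then show ?thesis
    by (rule many_colorsI[OF joins, rotated]) (use n_simps p_less p_ge arc_below u v in auto)
next
  case False
  let ?xs = "arc u p @ rev (arc v n)"
  have "joins B u (arc u p) p" "joins B 0 (rev (arc v n)) v"
    using joins_rev[OF B_sym arc(1)[of v n]] arc(1)[of u p] u v n_simps by auto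
  moreover have "set (arc u p) \<inter> set (rev (arc v n)) = {}" "B p 0"
  proof -
    have "set (arc v n) = insert 0 {v..<n}"
    proof -
      have "{v..n} = insert n {v..<n}" using v by auto
      then show ?thesis using arc(4)[of v n] v by auto
    qed
    then show "set (arc u p) \<inter> set (rev (arc v n)) = {}" using arc_below[of p u] u v by auto
  qed (use u v in \<open>auto simp: B_def\<close>)
  ultimately have joins: "joins B u ?xs v" by (intro joins_append)
  have ne: "rev (arc v n) \<noteq> []" "arc u p \<noteq> []" "hd (rev (arc v n)) = 0" "last (arc u p) = p"
    using \<open>joins B u (arc u p) p\<close> \<open>joins B 0 (rev (arc v n)) v\<close> by (auto simp: joins_def)
  have colors: "set (map C (path_edges ?xs)) =
      side_color ` {u..<p} \<union> {n - p} \<union> side_color ` {v..<n}"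
  proof -
    have "set (map C (path_edges (arc u p))) = side_color ` {u..<p}"
      using u v by (subst edge_color_arc) auto
    moreover have "set (map C (path_edges (arc v n))) = side_color ` {v..<n}"
      using u v by (subst edge_color_arc) auto
    ultimately show ?thesis
      using ne by (simp add: path_edges_append path_edges_rev insert_commute[of p 0] edge_color_chord image_Un)
  qed
  have "{k - p..n - p} \<subseteq> set (map C (path_edges ?xs))"
  proof
    fix t assume t: "t \<in> {k - p..n - p}"
    consider "t = n - p" | "v - p \<le> t" "t < n - p" | "t < v - p" using t by force
    then have "t \<in> side_color ` {u..<p} \<union> {n - p} \<union> side_color ` {v..<n}"
    proof cases
      case 2
      then show ?thesis using side_color_image[of v n] v by auto
    next
      case 3
      then have "t \<in> {k - p..k - 2}" "k - 2 - t \<in> {u..<p}" using False t by auto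
      then show ?thesis using side_color_short[of t] by blast
    qed simp
    then show "t \<in> set (map C (path_edges ?xs))" unfolding colors .
  qed
  then show ?thesis
    by (rule many_colorsI[OF joins, rotated]) (use n_simps p_less p_ge arc(2)[of u p] arc(2)[of v n] u v in auto)
qed

lemma many_colors:
  assumes "u < n" "v < n" "u \<noteq> v"
  shows "many_colors u v"
proof -
  have less: "many_colors u v" if uv: "u < v" "v < n" for u v
  proof -
    consider "v \<le> p" | "p \<le> u" | "u = 0" "p < v" | "0 < u" "u < p" "p < v" by linarith
    then show ?thesis
    proof cases
      case 1
      then show ?thesis using many_colors_within_shorter uv by blast
    next
      case 2
      then show ?thesis using many_colors_within_longer[of u v] uv by simp
    next
      case 3
      then show ?thesis using many_colors_within_longer[of v n] many_colors_sym uv by simp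
    next
      case 4
      then show ?thesis using many_colors_across uv by blast
    qed
  qed
  then show ?thesis using assms many_colors_sym by (cases "u < v") auto
qed

lemma C_less: "B u v \<Longrightarrow> C {u, v} < n - p + 1"
  using n_simps p_ge p_less by (intro edge_color_bound) (auto simp: side_color_def)

section \<open>Rainbow paths on the cycle\<close>

definition w :: nat where "w = p div 2"

text \<open>From \<open>w\<close>, the middle of the shorter side, the edges are colored
  \<open>0..k - 1\<close> and then \<open>0..k - 2\<close>. So the color \<open>k - 1\<close> occurs
  only on the edge opposite to \<open>w\<close>. Adding \<open>n\<close> avoids truncated
  subtraction.\<close>

definition offset_color :: "nat \<Rightarrow> nat" where
  "offset_color q = (q + n - w) mod n mod k"

abbreviation D :: "nat edge_coloring" where "D \<equiv> edge_color offset_color 0"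

lemma w_less: "w < p" "w < n"
  using p_ge n_simps by (auto simp: w_def)

lemma offset_color_mod: "offset_color (q mod n) = offset_color q"
proof -
  have "q mod n + n - w = q mod n + (n - w)" "q + n - w = q + (n - w)" using w_less by auto
  then show ?thesis by (simp only: offset_color_def mod_add_left_eq)
qed

text \<open>Two cycle edges of equal color are \<open>k\<close> apart one way around and
  \<open>n - k = k - 1\<close> apart the other way.\<close>

lemma offset_color_neq:
  assumes "q < r" "r - q + 2 \<le> k"
  shows "offset_color q \<noteq> offset_color r"
proof
  assume eq: "offset_color q = offset_color r"
  define a d where "a = (q + n - w) mod n" and "d = r - q"
  have d: "1 \<le> d" "d + 2 \<le> k" using assms by (auto simp: d_def)
  have "r + n - w = q + n - w + d" using assms w_less by (auto simp: d_def)
  then have r: "(r + n - w) mod n = (a + d) mod n" by (simp add: a_def mod_add_left_eq)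
  have "a < n" using n_simps by (simp add: a_def)
  show False
  proof (cases "a + d < n")
    case True
    then have "a mod k = (a + d) mod k" using eq r by (simp add: offset_color_def a_def)
    then have "k dvd d" using mod_eq_dvd_iff_nat[of a "a + d" k] by simp
    then show False using d by (auto dest: dvd_imp_le)
  next
    case False
    define b where "b = a + d - n"
    have b: "a = b + (n - d)" using False d n_simps by (auto simp: b_def)
    have "(a + d) mod n = b"
      using False \<open>a < n\<close> d n_simps by (simp add: b_def mod_if)
    then have "b mod k = (b + (n - d)) mod k" using eq r b by (simp add: offset_color_def a_def)
    then have "k dvd n - d" using mod_eq_dvd_iff_nat[of b "b + (n - d)" k] by simp
    then obtain m where m: "n - d = k * m" by blast
    \<comment> \<open>Past \<open>w\<close> the positions differ by \<open>n - d\<close>, which lies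
      strictly between \<open>k\<close> and \<open>2 * k\<close>.\<close>
    have "k < k * m" "k * m < k * 2" unfolding m[symmetric] using d n_simps by linarith+
    then show False by (auto simp: mult_less_cancel1)
  qed
qed

lemma distinct_arc:
  assumes "i \<le> j" "j - i + 1 \<le> k"
  shows "distinct (map D (path_edges (arc i j)))"
proof -
  have "inj_on (\<lambda>q. offset_color (q mod n)) {i..<j}"
    unfolding offset_color_mod
    using assms by (intro linorder_inj_onI offset_color_neq) auto
  then show ?thesis using assms n_simps by (subst edge_color_arc) (auto simp: distinct_map)
qed

text \<open>Since \<open>n = 2 * k - 1\<close>, one of the two arcs between distinct vertices has at
  most \<open>k - 1\<close> edges, and such arcs are rainbow.\<close>

lemma rainbow_path:
  assumes "u < n" "v < n" "u \<noteq> v"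
  shows "\<exists>xs. joins B u xs v \<and> set xs \<subseteq> {..<n} \<and> distinct (map D (path_edges xs))"
proof -
  have short: "\<exists>xs. joins B (i mod n) xs (j mod n) \<and> set xs \<subseteq> {..<n} \<and> distinct (map D (path_edges xs))"
    if "i \<le> j" "j - i + 1 \<le> k" for i j
    using that arc[of i j] distinct_arc[of i j] n_simps by (intro exI[of _ "arc i j"]) auto
  have rev: "\<exists>xs. joins B v xs u \<and> set xs \<subseteq> {..<n} \<and> distinct (map D (path_edges xs))"
    if "joins B u xs v" "set xs \<subseteq> {..<n}" "distinct (map D (path_edges xs))" for u v xs
    using that joins_rev[OF B_sym that(1)]
    by (intro exI[of _ "rev xs"]) (auto simp: path_edges_rev rev_map[symmetric])
  have less: "\<exists>xs. joins B u xs v \<and> set xs \<subseteq> {..<n} \<and> distinct (map D (path_edges xs))"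
    if uv: "u < v" "v < n" for u v
  proof (cases "v - u + 1 \<le> k")
    case True
    then show ?thesis using short[of u v] uv by simp
  next
    case False
    then have "\<exists>xs. joins B v xs u \<and> set xs \<subseteq> {..<n} \<and> distinct (map D (path_edges xs))"
      using short[of v "u + n"] uv n_simps by simp
    then show ?thesis using rev by blast
  qed
  show ?thesis
  proof (cases "u < v")
    case True
    then show ?thesis using less assms by blast
  next
    case False
    then have "v < u" using assms by simp
    then show ?thesis using less[of v u] rev assms by blast
  qed
qed

text \<open>An arc of at most \<open>k - 1\<close> edges with an end at \<open>w\<close> does not
  reach the edge opposite to \<open>w\<close>, the only cycle edge of color
  \<open>k - 1\<close>.\<close>

lemma escape_path:
  assumes "v < n"
  shows "\<exists>xs. joins B w xs v \<and> set xs \<subseteq> {..<n} \<and> distinct (map D (path_edges xs)) \<and>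
    (\<forall>e\<in>set (path_edges xs). D e < k - 1)"
proof -
  \<comment> \<open>This is the representative of \<open>v\<close> in
    \<open>{w..<w + n}\<close>.\<close>
  define j where "j = (if w \<le> v then v else v + n)"
  have j: "w \<le> j" "j < w + n" "j mod n = v" using assms w_less by (auto simp: j_def)
  have offset: "offset_color (q mod n) = (q - w) mod k" if "w \<le> q" "q < w + n" for q
  proof -
    have "q + n - w = q - w + n" "q - w < n" using that by auto
    have "offset_color (q mod n) = offset_color q" by (rule offset_color_mod)
    also have "\<dots> = (q - w + n) mod n mod k"
      unfolding offset_color_def by (simp only: \<open>q + n - w = q - w + n\<close>)
    also have "\<dots> = (q - w) mod k" using \<open>q - w < n\<close> by simp
    finally show ?thesis .
  qed
  show ?thesis
  proof (cases "j - w + 1 \<le> k")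
    case True
    have "\<forall>e\<in>set (path_edges (arc w j)). D e < k - 1"
      using j True p_less by (auto simp: arc edge_color_E offset)
    then show ?thesis
      using arc(1,2)[OF j(1,2)] distinct_arc[OF j(1) True] j(3) w_less by (intro exI[of _ "arc w j"]) auto
  next
    case False
    have le: "j \<le> w + n" "w + n < j + n" "w + n - j + 1 \<le> k" using False j n_simps by auto
    have "D e < k - 1" if "e \<in> set (path_edges (arc j (w + n)))" for e
    proof -
      obtain q where q: "e = E q" "j \<le> q" "q < w + n" using \<open>e \<in> _\<close> arc(3)[OF le(1,2)] by auto
      have "(q - w) mod k = q - w - k"
        using le_mod_geq[of k "q - w"] False q n_simps by simp
      moreover have "q - w - k < k - 1" using q False n_simps by auto
      ultimately show ?thesis using q j by (simp add: edge_color_E offset)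
    qed
    moreover have "joins B w (rev (arc j (w + n))) v"
      using joins_rev[OF B_sym arc(1)[OF le(1,2)]] j(3) w_less by simp
    ultimately show ?thesis
      using arc(2)[OF le(1,2)] distinct_arc[OF le(1,3)]
      by (intro exI[of _ "rev (arc j (w + n))"]) (auto simp: path_edges_rev rev_map[symmetric])
  qed
qed

lemma D_le: "B u v \<Longrightarrow> D {u, v} \<le> k - 1"
  using edge_color_bound[of offset_color k 0 u v] p_less by (auto simp: offset_color_def)

text \<open>The chord \<open>{0, p}\<close> joins vertices at cyclic distances \<open>w\<close> and \<open>p - w\<close> from \<open>w\<close>. Since these
  differ by at most 1, the chord does not shorten any distance from \<open>w\<close>.\<close>

definition dist_w :: "nat \<Rightarrow> int" where
  "dist_w v = min \<bar>int v - int w\<bar> (int n - \<bar>int v - int w\<bar>)"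

lemma dist_w_Lipschitz:
  assumes "B u v"
  shows "\<bar>dist_w u - dist_w v\<bar> \<le> 1"
proof -
  have w: "2 * int w \<le> int p" "int p \<le> 2 * int w + 1" unfolding w_def by linarith+
  have E: "\<bar>dist_w x - dist_w (Suc x mod n)\<bar> \<le> 1" if "x < n" for x
  proof (cases "Suc x = n")
    case True
    then show ?thesis using w n_simps by (simp add: dist_w_def; linarith)
  next
    case False
    then show ?thesis using that by (simp add: dist_w_def; linarith)
  qed
  have "\<bar>dist_w 0 - dist_w p\<bar> \<le> 1" using w n_simps by (simp add: dist_w_def; linarith)
  then show ?thesis
    using assms E[of u] E[of v] unfolding B_def doubleton_eq_iff by auto
qed

lemma dist_w_far: "dist_w w = 0" "w + (k - 1) < n" "dist_w (w + (k - 1)) = int (k - 1)"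
  using n_simps p_less w_less by (auto simp: dist_w_def)

end

section \<open>Choice of the parameters in the two cases\<close>

theorem theorem4p5:
  fixes k a b :: nat
  assumes "k \<ge> 2" and "b \<ge> a" and "k \<le> a" and "a \<le> 2 * k - 2"
  shows "\<exists>G :: nat pair_pre_digraph.
           pair_graph G \<and> Digraph_Component.connected (with_proj G) \<and>
           cc k G = enat a \<and> rc G = enat b"
proof (cases "a = k")
  case True
  \<comment> \<open>The base is a single vertex, so \<open>h = 0\<close> and the \<open>b\<close>
    levels alone give distance \<open>b\<close>.\<close>
  interpret T: tailed_graph 1 "\<lambda>_ _. False" 0 k b
    using assms by unfold_locales (auto simp: symp_def)
  have escapes: "T.escapes 0 (\<lambda>_. 0)"
    unfolding T.escapes_def by (auto simp: joins_def intro!: exI[of _ "[0]"])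
  have "rc T.G = enat (0 + b)" "Digraph_Component.connected (with_proj T.G)"
    by (rule T.rc_tail[OF escapes, where f = "\<lambda>_. 0" and t = 0]; simp)+
  moreover have "cc k T.G = enat a"
    by (rule T.cc_tail[OF escapes, where c = "\<lambda>_. 0"]) (use assms True in auto)
  ultimately show ?thesis using T.pair_graph_G by auto
next
  case False
  \<comment> \<open>The bounds \<open>a \<le> 2 * k - 2\<close> and \<open>k < a\<close> become
    \<open>2 \<le> p\<close> and \<open>p < k\<close>.\<close>
  define p where "p = 2 * k - a"
  interpret C: chorded_cycle k p
    using assms False by unfold_locales (auto simp: p_def)
  \<comment> \<open>The base contributes \<open>k - 1\<close> to the distance, the tail the rest of
    \<open>b\<close>; it has a level because \<open>k < a \<le> b\<close>.\<close>
  interpret T: tailed_graph C.n C.B C.w k "b - (k - 1)"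
    using assms False C.B_sym C.B_irrefl C.w_less by unfold_locales auto
  have escapes: "T.escapes (k - 1) C.D"
    using C.escape_path by (auto simp: T.escapes_def)
  have "rc T.G = enat (k - 1 + (b - (k - 1)))" "Digraph_Component.connected (with_proj T.G)"
    by (rule T.rc_tail[OF escapes C.rainbow_path C.D_le C.dist_w_Lipschitz C.dist_w_far]; assumption)+
  moreover have "C.n - p + 1 = a" using assms False by (auto simp: C.n_def p_def)
  then have "cc k T.G = enat a"
    using C.many_colors C.C_less C.num_colors_ge assms(3)
    by (intro T.cc_tail[OF escapes, where c = C.C]) (auto simp: C.many_colors_def)
  ultimately show ?thesis using T.pair_graph_G assms False by auto
qed

end
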